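(* Let $N\ge 2$, $\Delta x>0$, $\gamma>1$, and consider the one-species compressible Euler equations with ideal-gas law, discretized on $N$ cells with the local Lax--Friedrichs flux. Given an admissible state $(\mathbf U_i^n)_{i=1}^N$ and $\Delta t>0$, define the flux-balanced modified Patankar--Euler scheme, for $i=1,\dots,N$, by $$U_{i,1}^{n+1}=U_{i,1}^n+\frac{\Delta t}{\Delta x} r^{p,n}_{i,1}+\frac{\Delta t}{\Delta x}\Big(\sum_{j=1}^N p^n_{i,j,1}w_j^{n+1}-\Big(r^{d,n}_{i,1}+\sum_{j=1}^N d^n_{i,j,1}\Big)w_i^{n+1}\Big),$$ $$U_{i,k}^{n+1}=U_{i,k}^n+\frac{\Delta t}{\Delta x}\mathfrak r^{p,n}_{i,k}+\frac{\Delta t}{\Delta x}\Big(\sum_{j=1}^N \mathfrak p^n_{i,j,k}w_j^{n+1}-\Big(\mathfrak r^{d,n}_{i,k}+\sum_{j=1}^N \mathfrak d^n_{i,j,k}\Big)w_i^{n+1}\Big),\quad k=2,3,$$ with $w_i^{n+1}=U_{i,1}^{n+1}/U_{i,1}^n$ (all other quantities are defined in the context and evaluated at time level $n$). Then: (1) The scheme is first-order accurate. (2) The scheme unconditionally preserves the positivity of the density: for every $\Delta t>0$ and every admissible $(\mathbf U^n_i)_i$, the new state is well defined and $U_{i,1}^{n+1}>0$ for all $i$. (3) If the velocity and the pressure are initially constant, i.e. there are $\bar u\in\mathbb R$, $\bar p>0$ with $u_i^0=\bar u$ and $p_i^0=\bar p$ for all $i$ (and the ghost states have the same velocity and pressure),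 then $u_i^n=\bar u$ and $p_i^n=\bar p$ for all $i$ and all $n\ge 0$.
   Context: State: $\mathbf U=(U_1,U_2,U_3)^T=(\rho,\rho u,\rho E)^T$, $\mathbf F(\mathbf U)=(\rho u,\rho u^2+p,u(\rho E+p))^T$, internal energy $e=\rho E-\tfrac12\rho u^2$, equation of state $p=(\gamma-1)e$, sound speed $c(\mathbf U)=\sqrt{\gamma p/\rho}$. A state is admissible if $\rho>0$ and $p>0$; a grid state $(\mathbf U_i)_{i=1}^N$ is admissible if each $\mathbf U_i$ is. Grid: cells $i=1,\dots,N$ of width $\Delta x$, interfaces $i+\frac12$, $i=0,\dots,N$. Ghost states $\mathbf U_0,\mathbf U_{N+1}$ are admissible states determined by the boundary conditions as locally Lipschitz functions of the interior cell values (e.g. homogeneous Neumann: $\mathbf U_0=\mathbf U_1$, $\mathbf U_{N+1}=\mathbf U_N$). For a quantity $g$ put $\{\!\{g\}\!\}_{i+\frac12}=\frac12(g_i+g_{i+1})$ and $[\![g]\!]_{i+\frac12}=g_{i+1}-g_i$. Local Lax--Friedrichs flux: $$\hat{\mathbf F}_{i+\frac12}=\{\!\{\mathbf F(\mathbf U)\}\!\}_{i+\frac12}-\tfrac{\alpha_{i+\frac12}}{2}[\![\mathbf U]\!]_{i+\frac12},$$ $$\alpha_{i+\frac12}=\max\{|u_i|+c(\mathbf U_i),\ |u_{i+1}|+c(\mathbf U_{i+1}),\ |\{\!\{u\}\!\}_{i+\frac12}|+c(\{\!\{\mathbf U\}\!\}_{i+\frac12})\}.$$ $\hat F_{i+\frac12,k}$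 denotes the $k$-th component. Density terms: for $i=1,\dots,N-1$, $p_{i+1,i,1}=d_{i,i+1,1}=\max\{0,\hat F_{i+\frac12,1}\}$ and $p_{i,i+1,1}=d_{i+1,i,1}=-\min\{0,\hat F_{i+\frac12,1}\}$; $p_{i,j,1}=d_{i,j,1}=0$ if $|i-j|\ne1$. Boundary terms: $r^p_{i,1}=\max\{0,\hat F_{\frac12,1}\}\delta_{i,1}+\max\{0,-\hat F_{N+\frac12,1}\}\delta_{i,N}$ and $r^d_{i,1}=-\min\{0,\hat F_{\frac12,1}\}\delta_{i,1}-\min\{0,-\hat F_{N+\frac12,1}\}\delta_{i,N}$ ($\delta$ is the Kronecker delta). Splitting of momentum and energy fluxes, $\hat F_{i+\frac12,k}=\hat F^w_{i+\frac12,k}+\hat F^u_{i+\frac12,k}$, $k=2,3$: $$\hat F^w_{i+\frac12,2}=\{\!\{\rho u^2\}\!\}_{i+\frac12}-\tfrac{\alpha_{i+\frac12}}2[\![\rho u]\!]_{i+\frac12},\qquad \hat F^u_{i+\frac12,2}=\{\!\{p\}\!\}_{i+\frac12},$$ $$\hat F^w_{i+\frac12,3}=\{\!\{\tfrac12\rho u^3\}\!\}_{i+\frac12}-\tfrac{\alpha_{i+\frac12}}2[\![\tfrac12\rho u^2]\!]_{i+\frac12},\qquad \hat F^u_{i+\frac12,3}=\{\!\{u(e+p)\}\!\}_{i+\frac12}-\tfrac{\alpha_{i+\frac12}}2[\![e]\!]_{i+\frac12}.$$ Auxiliary terms, $k=2,3$: for $i=1,\dots,N-1$, $\mathfrak p_{i,i+1,k}=-\hat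 F^w_{i+\frac12,k}$ if $\hat F_{i+\frac12,1}<0$ and $0$ otherwise; $\mathfrak d_{i,i+1,k}=\hat F^w_{i+\frac12,k}$ if $\hat F_{i+\frac12,1}\ge0$ and $0$ otherwise; $\mathfrak p_{i,j,k}=\mathfrak d_{j,i,k}$ for all $i,j$; both vanish if $|i-j|\neq1$. Further $\mathfrak r^d_{1,k}=-\hat F^w_{\frac12,k}$ if $\hat F_{\frac12,1}<0$ and $0$ otherwise; $\mathfrak r^d_{N,k}=\hat F^w_{N+\frac12,k}$ if $\hat F_{N+\frac12,1}\ge0$ and $0$ otherwise; $\mathfrak r^d_{i,k}=0$ for $1<i<N$. Finally $$\mathfrak r^p_{i,k}=r_{i,k}+\mathfrak r^d_{i,k}+(\hat F^u_{i-\frac12,k}-\hat F^u_{i+\frac12,k}),\qquad r_{i,k}=\hat F^w_{\frac12,k}\delta_{i,1}-\hat F^w_{N+\frac12,k}\delta_{i,N}.$$ First-order accurate means first order in time: for fixed $\Delta x$ and fixed admissible $(\mathbf U_i^n)_i$, if $\mathbf U_i(t)$ solves the semi-discrete system $\frac{d}{dt}\mathbf U_i=\frac1{\Delta x}(\hat{\mathbf F}_{i-\frac12}-\hat{\mathbf F}_{i+\frac12})$, $i=1,\dots,N$, with $\mathbf U_i(t_n)=\mathbf U_i^n$, then $\mathbf U_i^{n+1}=\mathbf U_i(t_n+\Delta t)+\mathcal O(\Delta t^2)$ as $\Delta t\to0$. *)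

theory Defs
  imports "HOL-Analysis.Analysis" "HOL-Library.Landau_Symbols"
begin

section \<open>Euler equations\<close>

text \<open>A state is \<open>U = (\<rho>, \<rho> u, \<rho> E)\<close>.\<close>

type_synonym state = "real ^ 3"

definition rho :: "state \<Rightarrow> real" where
  "rho U = U $ 1"

definition vel :: "state \<Rightarrow> real" where
  "vel U = U $ 2 / U $ 1"

definition tot_en :: "state \<Rightarrow> real" where
  "tot_en U = U $ 3"

definition int_en :: "state \<Rightarrow> real" where
  "int_en U = tot_en U - 1/2 * rho U * (vel U)^2"

definition pres :: "real \<Rightarrow> state \<Rightarrow> real" where
  "pres \<gamma> U = (\<gamma> - 1) * int_en U"

definition sound :: "real \<Rightarrow> state \<Rightarrow> real" where
  "sound \<gamma> U = sqrt (\<gamma> * pres \<gamma> U / rho U)"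

definition flux :: "real \<Rightarrow> state \<Rightarrow> state" where
  "flux \<gamma> U = vector [rho U * vel U,
                      rho U * (vel U)^2 + pres \<gamma> U,
                      vel U * (tot_en U + pres \<gamma> U)]"

definition admissible_state :: "real \<Rightarrow> state \<Rightarrow> bool" where
  "admissible_state \<gamma> U \<longleftrightarrow> rho U > 0 \<and> pres \<gamma> U > 0"


section \<open>Grid functions and ghost states\<close>

text \<open>Only the values at the cells \<open>1, \<dots>, N\<close> of a grid function are meaningful; statements
  about grid functions are restricted to these indices.\<close>

type_synonym grid = "nat \<Rightarrow> state"

definition admissible :: "real \<Rightarrow> nat \<Rightarrow> grid \<Rightarrow> bool" where
  "admissible \<gamma> N U \<longleftrightarrow> (\<forall>i\<in>{1..N}. admissible_state \<gamma> (U i))"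

text \<open>A ghost state as a function \<open>G\<close> of the interior values: it is admissible, and locally Lipschitz
  on the set of admissible grid functions. Distances involve the cells \<open>1, \<dots>, N\<close> only, so that
  the Lipschitz bound also forces \<open>G\<close> to depend on the interior values only.\<close>

definition ghost_map :: "real \<Rightarrow> nat \<Rightarrow> (grid \<Rightarrow> state) \<Rightarrow> bool" where
  "ghost_map \<gamma> N G \<longleftrightarrow>
     (\<forall>U. admissible \<gamma> N U \<longrightarrow> admissible_state \<gamma> (G U)) \<and>
     (\<forall>U. admissible \<gamma> N U \<longrightarrow>
        (\<exists>\<epsilon>>0. \<exists>L. \<forall>V W.
           admissible \<gamma> N V \<and> (\<forall>i\<in>{1..N}. dist (V i) (U i) < \<epsilon>) \<and>
           admissible \<gamma> N W \<and> (\<forall>i\<in>{1..N}. dist (W i) (U i) < \<epsilon>) \<longrightarrow>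
           dist (G V) (G W) \<le> L * (\<Sum>i=1..N. dist (V i) (W i))))"

definition extend :: "nat \<Rightarrow> (grid \<Rightarrow> state) \<Rightarrow> (grid \<Rightarrow> state) \<Rightarrow> grid \<Rightarrow> grid" where
  "extend N GL GR U = (\<lambda>i. if i = 0 then GL U else if i = N + 1 then GR U else U i)"


section \<open>Local Lax--Friedrichs flux\<close>

text \<open>From here on \<open>X\<close> is a grid function extended by ghost states to \<open>0, \<dots>, N + 1\<close>, and the
  interface \<open>i + 1/2\<close> between the cells \<open>i\<close> and \<open>i + 1\<close> is indexed by \<open>i\<close>.\<close>

definition avg :: "(nat \<Rightarrow> 'a::real_vector) \<Rightarrow> nat \<Rightarrow> 'a" where
  "avg g i = (1/2) *\<^sub>R (g i + g (i + 1))"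

definition jump :: "(nat \<Rightarrow> 'a::real_vector) \<Rightarrow> nat \<Rightarrow> 'a" where
  "jump g i = g (i + 1) - g i"

definition alpha :: "real \<Rightarrow> grid \<Rightarrow> nat \<Rightarrow> real" where
  "alpha \<gamma> X i = Max {\<bar>vel (X i)\<bar> + sound \<gamma> (X i),
                      \<bar>vel (X (i + 1))\<bar> + sound \<gamma> (X (i + 1)),
                      \<bar>avg (\<lambda>j. vel (X j)) i\<bar> + sound \<gamma> (avg X i)}"

definition Fhat :: "real \<Rightarrow> grid \<Rightarrow> nat \<Rightarrow> state" where
  "Fhat \<gamma> X i = avg (\<lambda>j. flux \<gamma> (X j)) i - (alpha \<gamma> X i / 2) *\<^sub>R jump X i"

text \<open>The splitting \<open>Fhat = Fw + Fu\<close> concerns the components \<open>k = 2, 3\<close> only; the value at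
  \<open>k = 1\<close> is never used.\<close>

definition Fw :: "real \<Rightarrow> grid \<Rightarrow> nat \<Rightarrow> 3 \<Rightarrow> real" where
  "Fw \<gamma> X i k =
     (if k = 2 then avg (\<lambda>j. rho (X j) * (vel (X j))^2) i
                    - alpha \<gamma> X i / 2 * jump (\<lambda>j. rho (X j) * vel (X j)) i
      else avg (\<lambda>j. 1/2 * rho (X j) * (vel (X j))^3) i
                    - alpha \<gamma> X i / 2 * jump (\<lambda>j. 1/2 * rho (X j) * (vel (X j))^2) i)"

definition Fu :: "real \<Rightarrow> grid \<Rightarrow> nat \<Rightarrow> 3 \<Rightarrow> real" where
  "Fu \<gamma> X i k =
     (if k = 2 then avg (\<lambda>j. pres \<gamma> (X j)) i
      else avg (\<lambda>j. vel (X j) * (int_en (X j) + pres \<gamma> (X j))) i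
                    - alpha \<gamma> X i / 2 * jump (\<lambda>j. int_en (X j)) i)"

lemma Fhat_split:
  assumes "rho (X i) \<noteq> 0" "rho (X (i + 1)) \<noteq> 0" "k = 2 \<or> k = 3"
  shows "Fhat \<gamma> X i $ k = Fw \<gamma> X i k + Fu \<gamma> X i k"
  using assms
  by (auto simp: Fhat_def Fw_def Fu_def avg_def jump_def flux_def rho_def vel_def int_en_def
      tot_en_def vector_3 field_simps power2_eq_square power3_eq_cube)


section \<open>Production and destruction terms\<close>

text \<open>The indices \<open>i\<close>, \<open>j\<close> range over \<open>1, \<dots>, N\<close>, so only interior interfaces occur in
  the two-index terms.\<close>

definition prod1 :: "real \<Rightarrow> grid \<Rightarrow> nat \<Rightarrow> nat \<Rightarrow> real" where
  "prod1 \<gamma> X i j =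
     (if i = j + 1 then max 0 (Fhat \<gamma> X j $ 1)
      else if j = i + 1 then - min 0 (Fhat \<gamma> X i $ 1)
      else 0)"

definition dest1 :: "real \<Rightarrow> grid \<Rightarrow> nat \<Rightarrow> nat \<Rightarrow> real" where
  "dest1 \<gamma> X i j =
     (if j = i + 1 then max 0 (Fhat \<gamma> X i $ 1)
      else if i = j + 1 then - min 0 (Fhat \<gamma> X j $ 1)
      else 0)"

definition rp1 :: "real \<Rightarrow> nat \<Rightarrow> grid \<Rightarrow> nat \<Rightarrow> real" where
  "rp1 \<gamma> N X i = max 0 (Fhat \<gamma> X 0 $ 1) * of_bool (i = 1)
                 + max 0 (- (Fhat \<gamma> X N $ 1)) * of_bool (i = N)"

definition rd1 :: "real \<Rightarrow> nat \<Rightarrow> grid \<Rightarrow> nat \<Rightarrow> real" where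
  "rd1 \<gamma> N X i = - min 0 (Fhat \<gamma> X 0 $ 1) * of_bool (i = 1)
                 - min 0 (- (Fhat \<gamma> X N $ 1)) * of_bool (i = N)"

text \<open>The second branch is the value of \<open>auxprod\<close> at \<open>(j, j + 1)\<close>.\<close>

definition auxdest :: "real \<Rightarrow> grid \<Rightarrow> 3 \<Rightarrow> nat \<Rightarrow> nat \<Rightarrow> real" where
  "auxdest \<gamma> X k i j =
     (if j = i + 1 then (if Fhat \<gamma> X i $ 1 \<ge> 0 then Fw \<gamma> X i k else 0)
      else if i = j + 1 then (if Fhat \<gamma> X j $ 1 < 0 then - Fw \<gamma> X j k else 0)
      else 0)"

definition auxprod :: "real \<Rightarrow> grid \<Rightarrow> 3 \<Rightarrow> nat \<Rightarrow> nat \<Rightarrow> real" where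
  "auxprod \<gamma> X k i j = auxdest \<gamma> X k j i"

definition auxrd :: "real \<Rightarrow> nat \<Rightarrow> grid \<Rightarrow> 3 \<Rightarrow> nat \<Rightarrow> real" where
  "auxrd \<gamma> N X k i =
     (if i = 1 then (if Fhat \<gamma> X 0 $ 1 < 0 then - Fw \<gamma> X 0 k else 0)
      else if i = N then (if Fhat \<gamma> X N $ 1 \<ge> 0 then Fw \<gamma> X N k else 0)
      else 0)"

definition auxr :: "real \<Rightarrow> nat \<Rightarrow> grid \<Rightarrow> 3 \<Rightarrow> nat \<Rightarrow> real" where
  "auxr \<gamma> N X k i = Fw \<gamma> X 0 k * of_bool (i = 1) - Fw \<gamma> X N k * of_bool (i = N)"

definition auxrp :: "real \<Rightarrow> nat \<Rightarrow> grid \<Rightarrow> 3 \<Rightarrow> nat \<Rightarrow> real" where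
  "auxrp \<gamma> N X k i = auxr \<gamma> N X k i + auxrd \<gamma> N X k i + (Fu \<gamma> X (i - 1) k - Fu \<gamma> X i k)"


section \<open>Semi-discrete system and modified Patankar--Euler scheme\<close>

definition semidiscrete_rhs ::
    "real \<Rightarrow> nat \<Rightarrow> real \<Rightarrow> (grid \<Rightarrow> state) \<Rightarrow> (grid \<Rightarrow> state) \<Rightarrow> grid \<Rightarrow> nat \<Rightarrow> state" where
  "semidiscrete_rhs \<gamma> N \<Delta>x GL GR U i =
     (1 / \<Delta>x) *\<^sub>R (Fhat \<gamma> (extend N GL GR U) (i - 1) - Fhat \<gamma> (extend N GL GR U) i)"

definition semidiscrete_solution ::
    "real \<Rightarrow> nat \<Rightarrow> real \<Rightarrow> (grid \<Rightarrow> state) \<Rightarrow> (grid \<Rightarrow> state) \<Rightarrow> real set \<Rightarrow> (real \<Rightarrow> grid) \<Rightarrow> bool" where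
  "semidiscrete_solution \<gamma> N \<Delta>x GL GR I U \<longleftrightarrow>
     (\<forall>t\<in>I. \<forall>i\<in>{1..N}.
        ((\<lambda>s. U s i) has_vector_derivative semidiscrete_rhs \<gamma> N \<Delta>x GL GR (U t) i) (at t within I))"

text \<open>The scheme is implicit in the weights \<open>w\<close>, hence a relation between the old grid function \<open>U\<close>
  and the new one \<open>V\<close>.\<close>

definition mpe_step ::
    "real \<Rightarrow> nat \<Rightarrow> real \<Rightarrow> (grid \<Rightarrow> state) \<Rightarrow> (grid \<Rightarrow> state) \<Rightarrow> real \<Rightarrow> grid \<Rightarrow> grid \<Rightarrow> bool" where
  "mpe_step \<gamma> N \<Delta>x GL GR \<Delta>t U V \<longleftrightarrow>
     (let X = extend N GL GR U; w = (\<lambda>i. V i $ 1 / U i $ 1) in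
      \<forall>i\<in>{1..N}.
        V i $ 1 = U i $ 1 + \<Delta>t / \<Delta>x * rp1 \<gamma> N X i
          + \<Delta>t / \<Delta>x * ((\<Sum>j=1..N. prod1 \<gamma> X i j * w j)
                       - (rd1 \<gamma> N X i + (\<Sum>j=1..N. dest1 \<gamma> X i j)) * w i) \<and>
        (\<forall>k\<in>{2, 3}.
          V i $ k = U i $ k + \<Delta>t / \<Delta>x * auxrp \<gamma> N X k i
            + \<Delta>t / \<Delta>x * ((\<Sum>j=1..N. auxprod \<gamma> X k i j * w j)
                         - (auxrd \<gamma> N X k i + (\<Sum>j=1..N. auxdest \<gamma> X k i j)) * w i)))"

text \<open>First order in time: local error \<open>O(\<Delta>t\<^sup>2)\<close> against any solution of the semi-discrete system
  on some interval \<open>[t\<^sub>n, t\<^sub>n + T)\<close> starting from the given admissible values. Admissibility of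
  the solution for small times follows from continuity.\<close>

definition first_order_accurate ::
    "real \<Rightarrow> nat \<Rightarrow> real \<Rightarrow> (grid \<Rightarrow> state) \<Rightarrow> (grid \<Rightarrow> state) \<Rightarrow> bool" where
  "first_order_accurate \<gamma> N \<Delta>x GL GR \<longleftrightarrow>
     (\<forall>Uo U V tn T.
        admissible \<gamma> N Uo \<and> T > 0 \<and>
        semidiscrete_solution \<gamma> N \<Delta>x GL GR {tn..<tn + T} U \<and>
        (\<forall>i\<in>{1..N}. U tn i = Uo i) \<and>
        (\<forall>\<Delta>t>0. mpe_step \<gamma> N \<Delta>x GL GR \<Delta>t Uo (V \<Delta>t)) \<longrightarrow>
        (\<forall>i\<in>{1..N}. (\<lambda>\<Delta>t. norm (V \<Delta>t i - U (tn + \<Delta>t) i)) \<in> O[at_right 0](\<lambda>\<Delta>t. \<Delta>t^2)))"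

definition const_vel_pres :: "real \<Rightarrow> nat \<Rightarrow> real \<Rightarrow> real \<Rightarrow> grid \<Rightarrow> bool" where
  "const_vel_pres \<gamma> N ub pb U \<longleftrightarrow> (\<forall>i\<in>{1..N}. vel (U i) = ub \<and> pres \<gamma> (U i) = pb)"

end

theory Submission
  imports Defs
begin

text \<open>
  With the weights \<open>w\<close> replaced by 1 the scheme is the explicit Euler step of the conservative
  discretization, so first order accuracy only requires \<open>w = 1 + O(\<Delta>t)\<close>. The weights solve a
  linear system with an M-matrix: in the variables \<open>y\<^sub>i = D\<^sub>i w\<^sub>i\<close>, where \<open>D\<close> is the diagonal of the
  system, it reads \<open>y = b + B y\<close> with \<open>b > 0\<close>, \<open>B \<ge> 0\<close> and column sums of \<open>B\<close> below 1, because
  every production term is a destruction term of another cell. The Neumann series gives a unique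
  positive solution, and the mass balance bounds it uniformly for \<open>\<Delta>t \<le> 1\<close>. For constant velocity
  and pressure the convective parts of the momentum and energy fluxes are the constant multiples
  \<open>u\<close> and \<open>u\<^sup>2 / 2\<close> of the mass flux, and the remaining parts are the same at every interface, so
  the three updates stay proportional.
\<close>

section \<open>Nonnegative systems with column sums below one\<close>

text \<open>Column sums below 1 make \<open>B\<close> a contraction in the l1 norm, so the Neumann
  series of \<open>b\<close> converges. Its terms are nonnegative and the first one is
  \<open>b\<close>, which gives strict positivity.\<close>

lemma nonneg_substochastic_system:
  fixes B :: "'a \<Rightarrow> 'a \<Rightarrow> real"
  assumes S: "finite S" "S \<noteq> {}"
    and B: "\<And>i j. i \<in> S \<Longrightarrow> j \<in> S \<Longrightarrow> B i j \<ge> 0"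
    and col: "\<And>j. j \<in> S \<Longrightarrow> (\<Sum>i\<in>S. B i j) < 1"
    and b: "\<And>i. i \<in> S \<Longrightarrow> b i > 0"
  obtains y where "\<And>i. i \<in> S \<Longrightarrow> y i = b i + (\<Sum>j\<in>S. B i j * y j)"
    and "\<And>i. i \<in> S \<Longrightarrow> y i > 0"
proof -
  define q where "q = Max ((\<lambda>j. \<Sum>i\<in>S. B i j) ` S)"
  have q: "(\<Sum>i\<in>S. B i j) \<le> q" if "j \<in> S" for j
    unfolding q_def using S that by (intro Max_ge) auto
  have q1: "q < 1" unfolding q_def using S col by (subst Max_less_iff) auto
  obtain j0 where "j0 \<in> S" using S by blast
  have q0: "q \<ge> 0" using q[OF \<open>j0 \<in> S\<close>] B \<open>j0 \<in> S\<close> by (meson order_trans sum_nonneg)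
  \<comment> \<open>The iterates \<open>B^n b\<close>, whose l1 norms decay like
    \<open>q ^ n\<close>.\<close>
  define z where "z = rec_nat b (\<lambda>_ v i. \<Sum>j\<in>S. B i j * v j)"
  have z0: "z 0 = b" and zS: "z (Suc n) i = (\<Sum>j\<in>S. B i j * z n j)" for n i
    by (simp_all add: z_def)
  have zn: "\<forall>i\<in>S. z n i \<ge> 0" for n
    by (induction n) (use b B in \<open>auto simp: z0 zS less_imp_le intro!: sum_nonneg mult_nonneg_nonneg\<close>)
  have zq: "(\<Sum>i\<in>S. z n i) \<le> q ^ n * (\<Sum>i\<in>S. b i)" for n
  proof (induction n)
    case (Suc n)
    have "(\<Sum>i\<in>S. z (Suc n) i) = (\<Sum>j\<in>S. (\<Sum>i\<in>S. B i j) * z n j)"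
      unfolding zS by (subst sum.swap) (simp add: sum_distrib_right)
    also have "\<dots> \<le> (\<Sum>j\<in>S. q * z n j)" by (intro sum_mono mult_right_mono q) (use zn in auto)
    also have "\<dots> = q * (\<Sum>j\<in>S. z n j)" by (simp add: sum_distrib_left)
    also have "\<dots> \<le> q * (q ^ n * (\<Sum>i\<in>S. b i))" by (intro mult_left_mono Suc q0)
    finally show ?case by (simp add: mult.assoc)
  qed (simp add: z0)
  have sm: "summable (\<lambda>n. z n i)" if "i \<in> S" for i
  proof (rule summable_comparison_test')
    show "summable (\<lambda>n. q ^ n * (\<Sum>i\<in>S. b i))"
      using q0 q1 by (intro summable_mult2 summable_geometric) auto
    fix n :: nat
    have "z n i \<le> (\<Sum>i\<in>S. z n i)" using S that zn by (intro member_le_sum) auto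
    then show "norm (z n i) \<le> q ^ n * (\<Sum>i\<in>S. b i)" using zq[of n] zn[of n] that by auto
  qed
  define y where "y i = (\<Sum>n. z n i)" for i
  show ?thesis
  proof
    fix i assume i: "i \<in> S"
    have "y i = z 0 i + (\<Sum>n. z (Suc n) i)" unfolding y_def using suminf_split_head[OF sm[OF i]] by simp
    also have "(\<Sum>n. z (Suc n) i) = (\<Sum>j\<in>S. B i j * y j)"
      unfolding zS y_def using sm by (simp add: suminf_sum suminf_mult summable_mult)
    finally show "y i = b i + (\<Sum>j\<in>S. B i j * y j)" by (simp add: z0)
    moreover have "y j \<ge> 0" if "j \<in> S" for j unfolding y_def using zn that by (intro suminf_nonneg sm) auto
    ultimately show "y i > 0" using b[OF i] B i by (simp add: add_pos_nonneg sum_nonneg)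
  qed
qed

text \<open>Applying \<open>B\<close> to a nonzero vector strictly decreases the l1 norm, so a fixed
  point must vanish. This yields uniqueness for the system above.\<close>

lemma substochastic_kernel_trivial:
  fixes B :: "'a \<Rightarrow> 'a \<Rightarrow> real"
  assumes S: "finite S"
    and B: "\<And>i j. i \<in> S \<Longrightarrow> j \<in> S \<Longrightarrow> B i j \<ge> 0"
    and col: "\<And>j. j \<in> S \<Longrightarrow> (\<Sum>i\<in>S. B i j) < 1"
    and y: "\<And>i. i \<in> S \<Longrightarrow> y i = (\<Sum>j\<in>S. B i j * y j)"
    and i: "i \<in> S"
  shows "y i = 0"
proof (rule ccontr)
  assume "y i \<noteq> 0"
  have "(\<Sum>i\<in>S. \<bar>y i\<bar>) \<le> (\<Sum>i\<in>S. \<Sum>j\<in>S. B i j * \<bar>y j\<bar>)"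
  proof (rule sum_mono)
    fix i assume i: "i \<in> S"
    have "\<bar>y i\<bar> \<le> (\<Sum>j\<in>S. \<bar>B i j * y j\<bar>)" by (subst y[OF i]) (rule sum_abs)
    also have "\<dots> = (\<Sum>j\<in>S. B i j * \<bar>y j\<bar>)" using B i by (intro sum.cong) (auto simp: abs_mult)
    finally show "\<bar>y i\<bar> \<le> (\<Sum>j\<in>S. B i j * \<bar>y j\<bar>)" .
  qed
  also have "\<dots> = (\<Sum>j\<in>S. (\<Sum>i\<in>S. B i j) * \<bar>y j\<bar>)"
    by (subst sum.swap) (simp add: sum_distrib_right)
  also have "\<dots> < (\<Sum>j\<in>S. 1 * \<bar>y j\<bar>)"
  proof (rule sum_strict_mono_ex1)
    show "\<forall>j\<in>S. (\<Sum>i\<in>S. B i j) * \<bar>y j\<bar> \<le> 1 * \<bar>y j\<bar>"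
      using col by (intro ballI mult_right_mono) (auto simp: less_imp_le)
    show "\<exists>j\<in>S. (\<Sum>i\<in>S. B i j) * \<bar>y j\<bar> < 1 * \<bar>y j\<bar>"
      using col[OF i] i \<open>y i \<noteq> 0\<close> by (intro bexI[of _ i] mult_strict_right_mono) auto
  qed (rule S)
  finally show False by simp
qed

section \<open>Patankar weighting of upwind fluxes\<close>

text \<open>Both the density terms and the auxiliary terms are upwind splittings by the sign of the mass
  flux \<open>F\<close>: the transported quantity \<open>G\<close> is \<open>F\<close> itself for the density and \<open>Fw\<close> for
  momentum and energy.\<close>

definition upwind :: "(nat \<Rightarrow> real) \<Rightarrow> (nat \<Rightarrow> real) \<Rightarrow> nat \<Rightarrow> nat \<Rightarrow> real" where
  "upwind F G i j =
     (if j = i + 1 then (if F i \<ge> 0 then G i else 0)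
      else if i = j + 1 then (if F j < 0 then - G j else 0)
      else 0)"

text \<open>Outflow through the two ends of the domain: interface 0 belongs to cell 1, interface
  \<open>N\<close> to cell \<open>N\<close>. The nested conditionals see both ends only if
  \<open>N \<ge> 2\<close>.\<close>

definition upwind_bdry :: "nat \<Rightarrow> (nat \<Rightarrow> real) \<Rightarrow> (nat \<Rightarrow> real) \<Rightarrow> nat \<Rightarrow> real" where
  "upwind_bdry N F G i =
     (if i = 1 then (if F 0 < 0 then - G 0 else 0)
      else if i = N then (if F N \<ge> 0 then G N else 0)
      else 0)"

text \<open>The net boundary flux with the outflow added back, because \<open>patankar\<close>
  subtracts that outflow again with the weight of the cell. For \<open>G = F\<close> only the
  incoming mass remains.\<close>

definition inflow :: "nat \<Rightarrow> (nat \<Rightarrow> real) \<Rightarrow> (nat \<Rightarrow> real) \<Rightarrow> nat \<Rightarrow> real" where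
  "inflow N F G i = G 0 * of_bool (i = 1) - G N * of_bool (i = N) + upwind_bdry N F G i"

text \<open>Common form of the right-hand side for all three components. The transposed
  \<open>upwind F G j i\<close> is the production in \<open>i\<close> from \<open>j\<close>, so
  whatever leaves one cell for another arrives there with the same weight.\<close>

definition patankar ::
    "nat \<Rightarrow> (nat \<Rightarrow> real) \<Rightarrow> (nat \<Rightarrow> real) \<Rightarrow> (nat \<Rightarrow> real) \<Rightarrow> nat \<Rightarrow> real" where
  "patankar N F G w i = inflow N F G i + (\<Sum>j=1..N. upwind F G j i * w j)
     - (upwind_bdry N F G i + (\<Sum>j=1..N. upwind F G i j)) * w i"

lemma upwind_nonneg: "upwind F F i j \<ge> 0"
  by (simp add: upwind_def)

lemma upwind_bdry_nonneg: "upwind_bdry N F F i \<ge> 0"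
  by (simp add: upwind_bdry_def)

lemma inflow_nonneg: "N \<ge> 2 \<Longrightarrow> inflow N F F i \<ge> 0"
  by (auto simp: inflow_def upwind_bdry_def)

lemma sum_upwind_out:
  assumes "i \<in> {1..N}"
  shows "(\<Sum>j=1..N. upwind F G i j) =
    (if i < N \<and> F i \<ge> 0 then G i else 0) + (if 1 < i \<and> F (i - 1) < 0 then - G (i - 1) else 0)"
proof -
  \<comment> \<open>Writing the left neighbour as \<open>j = i - 1\<close> is safe for
    \<open>i = 1\<close> too: truncated subtraction gives 0, outside the range of summation.\<close>
  have "(\<Sum>j=1..N. upwind F G i j) = (\<Sum>j=1..N. (if j = i + 1 then if F i \<ge> 0 then G i else 0 else 0)
      + (if j = i - 1 then if F (i - 1) < 0 then - G (i - 1) else 0 else 0))"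
    using assms by (intro sum.cong) (auto simp: upwind_def)
  then show ?thesis using assms by (auto simp: sum.distrib)
qed

lemma sum_upwind_in:
  assumes "i \<in> {1..N}"
  shows "(\<Sum>j=1..N. upwind F G j i) =
    (if 1 < i \<and> F (i - 1) \<ge> 0 then G (i - 1) else 0) + (if i < N \<and> F i < 0 then - G i else 0)"
proof -
  have "(\<Sum>j=1..N. upwind F G j i) = (\<Sum>j=1..N. (if j = i - 1 then if F (i - 1) \<ge> 0 then G (i - 1) else 0 else 0)
      + (if j = i + 1 then if F i < 0 then - G i else 0 else 0))"
    using assms by (intro sum.cong) (auto simp: upwind_def)
  then show ?thesis using assms by (auto simp: sum.distrib)
qed

text \<open>At each interface the sign of \<open>F\<close> only decides whether \<open>G\<close> is
  booked as production or as destruction; with equal weights both bookings give the same signed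
  flux. This is the source of consistency.\<close>

lemma patankar_unit_weights:
  assumes "N \<ge> 2" "i \<in> {1..N}"
  shows "patankar N F G (\<lambda>_. 1) i = G (i - 1) - G i"
  using assms sum_upwind_in[of i N F G] sum_upwind_out[of i N F G]
  by (auto simp: patankar_def inflow_def upwind_bdry_def)

text \<open>The sign of \<open>F\<close> alone selects the upwind branch, so the expression is
  linear in \<open>G\<close>. This turns proportional fluxes into proportional updates, whatever the
  sign of the factor.\<close>

lemma patankar_scale: "patankar N F (\<lambda>j. c * G j) w i = c * patankar N F G w i"
proof -
  have "upwind F (\<lambda>j. c * G j) i j = c * upwind F G i j" for i j by (simp add: upwind_def)
  moreover have "upwind_bdry N F (\<lambda>j. c * G j) i = c * upwind_bdry N F G i"
    by (simp add: upwind_bdry_def)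
  ultimately show ?thesis
    by (simp add: patankar_def inflow_def algebra_simps sum_distrib_left)
qed

text \<open>Weights outside the cells and fluxes beyond interface \<open>N\<close> never enter, so
  equalities known only on the grid can be used.\<close>

lemma patankar_cong:
  assumes i: "i \<in> {1..N}" and w: "\<And>j. j \<in> {1..N} \<Longrightarrow> w j = w' j"
    and G: "\<And>j. j \<le> N \<Longrightarrow> G j = G' j"
  shows "patankar N F G w i = patankar N F G' w' i"
proof -
  have u: "upwind F G j k = upwind F G' j k" if "j \<in> {1..N}" "k \<in> {1..N}" for j k
    using that by (auto simp: upwind_def G)
  have "(\<Sum>j=1..N. upwind F G j i * w j) = (\<Sum>j=1..N. upwind F G' j i * w' j)"
    using u w i by (intro sum.cong) auto
  moreover have "(\<Sum>j=1..N. upwind F G i j) = (\<Sum>j=1..N. upwind F G' i j)"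
    using u i by (intro sum.cong) auto
  moreover have "upwind_bdry N F G i = upwind_bdry N F G' i" "inflow N F G i = inflow N F G' i"
    by (auto simp: upwind_bdry_def inflow_def G)
  ultimately show ?thesis using w[OF i] by (simp add: patankar_def)
qed

text \<open>Here \<open>r\<close> stands for the old densities and \<open>c\<close> for
  \<open>\<Delta>t / \<Delta>x\<close>. Scaling each unknown by its diagonal entry reduces the
  M-matrix system to the substochastic one, for arbitrarily large \<open>c\<close>.\<close>

lemma patankar_system:
  assumes "N \<ge> 2" "c \<ge> 0" and r_pos: "\<forall>i\<in>{1..N}. r i > 0"
  shows "\<exists>w. (\<forall>i\<in>{1..N}. r i * w i = r i + c * patankar N F F w i \<and> w i > 0) \<and>
    (\<forall>w'. (\<forall>i\<in>{1..N}. r i * w' i = r i + c * patankar N F F w' i) \<longrightarrow>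
      (\<forall>i\<in>{1..N}. w' i = w i))"
proof -
  note r = bspec[OF r_pos]
  define D where "D i = r i + c * (upwind_bdry N F F i + (\<Sum>j=1..N. upwind F F i j))" for i
  have D: "D i > 0" if "i \<in> {1..N}" for i
    unfolding D_def using r[OF that] \<open>c \<ge> 0\<close>
    by (intro add_pos_nonneg mult_nonneg_nonneg add_nonneg_nonneg sum_nonneg upwind_nonneg upwind_bdry_nonneg)
  \<comment> \<open>Entry \<open>(i, j)\<close> is the share of \<open>D j\<close> that cell
    \<open>j\<close> passes on to cell \<open>i\<close>; the rest contains \<open>r j > 0\<close>
    and keeps the column sum below 1.\<close>
  define B where "B i j = c * upwind F F j i / D j" for i j
  define b where "b i = r i + c * inflow N F F i" for i
  have B: "B i j \<ge> 0" if "i \<in> {1..N}" "j \<in> {1..N}" for i j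
    unfolding B_def using D[OF that(2)] \<open>c \<ge> 0\<close> by (simp add: upwind_nonneg)
  have col: "(\<Sum>i=1..N. B i j) < 1" if "j \<in> {1..N}" for j
  proof -
    have "(\<Sum>i=1..N. B i j) = c * (\<Sum>i=1..N. upwind F F j i) / D j"
      by (simp add: B_def sum_divide_distrib sum_distrib_left)
    also have "\<dots> < 1"
      using D[OF that] r[OF that] \<open>c \<ge> 0\<close> upwind_bdry_nonneg[of N F j]
      by (simp add: D_def add_pos_nonneg distrib_left)
    finally show ?thesis .
  qed
  have b: "b i > 0" if "i \<in> {1..N}" for i
    unfolding b_def using r[OF that] \<open>c \<ge> 0\<close> inflow_nonneg[OF \<open>N \<ge> 2\<close>] by (simp add: add_pos_nonneg)
  \<comment> \<open>The terms with \<open>w i\<close> are collected on the left, and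
    \<open>D j / D j\<close> is inserted in the production sum.\<close>
  have eq: "r i * w i = r i + c * patankar N F F w i
      \<longleftrightarrow> D i * w i = b i + (\<Sum>j=1..N. B i j * (D j * w j))" for i w
  proof -
    have "(\<Sum>j=1..N. B i j * (D j * w j)) = c * (\<Sum>j=1..N. upwind F F j i * w j)"
      unfolding sum_distrib_left using D by (intro sum.cong) (force simp: B_def)+
    then show ?thesis by (auto simp: D_def b_def patankar_def algebra_simps)
  qed
  obtain y where y: "\<And>i. i \<in> {1..N} \<Longrightarrow> y i = b i + (\<Sum>j=1..N. B i j * y j)"
      "\<And>i. i \<in> {1..N} \<Longrightarrow> y i > 0"
    using nonneg_substochastic_system[of "{1..N}" B b] B col b \<open>N \<ge> 2\<close> by auto
  define w where "w i = y i / D i" for i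
  have Dw: "D i * w i = y i" if "i \<in> {1..N}" for i using D[OF that] by (simp add: w_def)
  have "r i * w i = r i + c * patankar N F F w i \<and> w i > 0" if i: "i \<in> {1..N}" for i
  proof
    show "w i > 0" using y(2)[OF i] D[OF i] by (simp add: w_def)
    have "(\<Sum>j=1..N. B i j * (D j * w j)) = (\<Sum>j=1..N. B i j * y j)" by (intro sum.cong) (auto simp: Dw)
    then show "r i * w i = r i + c * patankar N F F w i" unfolding eq using y(1)[OF i] Dw[OF i] by simp
  qed
  moreover have "w' i = w i"
    if w': "\<forall>i\<in>{1..N}. r i * w' i = r i + c * patankar N F F w' i" and i: "i \<in> {1..N}" for w' i
  proof -
    \<comment> \<open>In the scaled unknowns the difference of two solutions satisfies the
      homogeneous system.\<close>
    have "D i * w' i - y i = 0"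
    proof (rule substochastic_kernel_trivial[OF _ B col _ i])
      fix i assume i: "i \<in> {1..N}"
      show "D i * w' i - y i = (\<Sum>j=1..N. B i j * (D j * w' j - y j))"
        using w'[unfolded eq] i y(1)[OF i] by (simp add: right_diff_distrib sum_subtractf)
    qed auto
    then show ?thesis using D[OF i] by (simp add: w_def field_simps)
  qed
  ultimately show ?thesis by blast
qed

text \<open>Summed over all cells, the weighted productions and destructions cancel; the boundary
  outflow that is left over is a loss, as the weights are nonnegative.\<close>

lemma sum_patankar_le:
  assumes "\<And>i. i \<in> {1..N} \<Longrightarrow> w i \<ge> 0"
  shows "(\<Sum>i=1..N. patankar N F F w i) \<le> (\<Sum>i=1..N. inflow N F F i)"
proof -
  have "(\<Sum>i=1..N. \<Sum>j=1..N. upwind F F j i * w j) = (\<Sum>i=1..N. (\<Sum>j=1..N. upwind F F i j) * w i)"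
    by (subst sum.swap) (simp add: sum_distrib_right)
  then have "(\<Sum>i=1..N. patankar N F F w i) = (\<Sum>i=1..N. inflow N F F i) - (\<Sum>i=1..N. upwind_bdry N F F i * w i)"
    by (simp add: patankar_def sum.distrib sum_subtractf distrib_right)
  moreover have "(\<Sum>i=1..N. upwind_bdry N F F i * w i) \<ge> 0"
    using assms by (intro sum_nonneg mult_nonneg_nonneg upwind_bdry_nonneg) auto
  ultimately show ?thesis by linarith
qed

section \<open>The scheme\<close>

definition mass_flux :: "real \<Rightarrow> grid \<Rightarrow> nat \<Rightarrow> real" where
  "mass_flux \<gamma> X i = Fhat \<gamma> X i $ 1"

text \<open>At \<open>k = 1\<close> the value of \<open>Fw\<close> is meaningless and the whole mass
  flux is convective; this choice puts density, momentum and energy into one formula.\<close>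

definition conv_part :: "real \<Rightarrow> grid \<Rightarrow> 3 \<Rightarrow> nat \<Rightarrow> real" where
  "conv_part \<gamma> X k i = (if k = 1 then mass_flux \<gamma> X i else Fw \<gamma> X i k)"

definition pres_part :: "real \<Rightarrow> grid \<Rightarrow> 3 \<Rightarrow> nat \<Rightarrow> real" where
  "pres_part \<gamma> X k i = (if k = 1 then 0 else Fu \<gamma> X i k)"

lemma conv_part_add_pres_part:
  assumes "rho (X i) \<noteq> 0" "rho (X (i + 1)) \<noteq> 0"
  shows "conv_part \<gamma> X k i + pres_part \<gamma> X k i = Fhat \<gamma> X i $ k"
  using Fhat_split[OF assms, of k \<gamma>] exhaust_3[of k]
  by (auto simp: conv_part_def pres_part_def mass_flux_def)

text \<open>The density terms fit the common form because the positive and negative parts of the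
  mass flux are exactly its upwind branches. All later arguments use this single formula over
  \<open>k\<close>.\<close>

lemma mpe_step_iff:
  fixes U V :: grid and GL GR :: "grid \<Rightarrow> state"
  assumes "N \<ge> 2"
  defines "X \<equiv> extend N GL GR U"
  shows "mpe_step \<gamma> N \<Delta>x GL GR \<Delta>t U V \<longleftrightarrow>
    (\<forall>i\<in>{1..N}. \<forall>k. V i $ k = U i $ k + \<Delta>t / \<Delta>x *
       (patankar N (mass_flux \<gamma> X) (conv_part \<gamma> X k) (\<lambda>i. V i $ 1 / U i $ 1) i
        + (pres_part \<gamma> X k (i - 1) - pres_part \<gamma> X k i)))"
proof -
  have mass: "dest1 \<gamma> X = upwind (mass_flux \<gamma> X) (conv_part \<gamma> X 1)"
    "prod1 \<gamma> X i j = upwind (mass_flux \<gamma> X) (conv_part \<gamma> X 1) j i"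
    "rd1 \<gamma> N X = upwind_bdry N (mass_flux \<gamma> X) (conv_part \<gamma> X 1)"
    "rp1 \<gamma> N X = inflow N (mass_flux \<gamma> X) (conv_part \<gamma> X 1)" for i j
    using assms by (auto simp: fun_eq_iff dest1_def prod1_def rd1_def rp1_def upwind_def
        upwind_bdry_def inflow_def conv_part_def mass_flux_def)
  have aux: "auxdest \<gamma> X k = upwind (mass_flux \<gamma> X) (conv_part \<gamma> X k)"
    "auxprod \<gamma> X k i j = upwind (mass_flux \<gamma> X) (conv_part \<gamma> X k) j i"
    "auxrd \<gamma> N X k = upwind_bdry N (mass_flux \<gamma> X) (conv_part \<gamma> X k)"
    "auxrp \<gamma> N X k i = inflow N (mass_flux \<gamma> X) (conv_part \<gamma> X k) i
       + (pres_part \<gamma> X k (i - 1) - pres_part \<gamma> X k i)" if "k \<in> {2, 3}" for k i j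
    using that by (auto simp: fun_eq_iff auxdest_def auxprod_def auxrd_def auxrp_def auxr_def upwind_def
        upwind_bdry_def inflow_def conv_part_def pres_part_def mass_flux_def)
  have nt: "pres_part \<gamma> X 1 = (\<lambda>_. 0)" by (simp add: pres_part_def fun_eq_iff)
  have all3: "(\<forall>k. P k) \<longleftrightarrow> P 1 \<and> (\<forall>k\<in>{2, 3}. P k)" for P :: "3 \<Rightarrow> bool"
    by (simp add: forall_3)
  show ?thesis
    unfolding mpe_step_def Let_def X_def[symmetric] all3
    by (intro ball_cong refl conj_cong)
       (simp_all only: mass aux nt patankar_def, simp_all add: algebra_simps)
qed

text \<open>The density component of the scheme is a closed linear system for the weights;
  uniqueness identifies \<open>w\<close> with its positive solution.\<close>

lemma mpe_step_weights:
  fixes U V :: grid and GL GR :: "grid \<Rightarrow> state"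
  assumes "N \<ge> 2" "\<Delta>x > 0" "\<Delta>t > 0" "admissible \<gamma> N U"
    and "mpe_step \<gamma> N \<Delta>x GL GR \<Delta>t U V"
  defines "X \<equiv> extend N GL GR U" and "w \<equiv> \<lambda>i. V i $ 1 / U i $ 1"
  assumes i: "i \<in> {1..N}"
  shows "U i $ 1 * w i = U i $ 1 + \<Delta>t / \<Delta>x * patankar N (mass_flux \<gamma> X) (mass_flux \<gamma> X) w i"
    and "w i > 0"
proof -
  have r: "U i $ 1 > 0" if "i \<in> {1..N}" for i
    using assms(4) that by (auto simp: admissible_def admissible_state_def rho_def)
  have t1: "conv_part \<gamma> X 1 = mass_flux \<gamma> X" "pres_part \<gamma> X 1 = (\<lambda>_. 0)"
    by (simp_all add: conv_part_def pres_part_def fun_eq_iff)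
  have eq: "U i $ 1 * w i = U i $ 1 + \<Delta>t / \<Delta>x * patankar N (mass_flux \<gamma> X) (mass_flux \<gamma> X) w i"
    if i: "i \<in> {1..N}" for i
  proof -
    have "U i $ 1 * w i = V i $ 1" using r[OF i] by (simp add: w_def)
    also have "\<dots> = U i $ 1 + \<Delta>t / \<Delta>x * patankar N (mass_flux \<gamma> X) (mass_flux \<gamma> X) w i"
      using assms(5)[unfolded mpe_step_iff[OF assms(1)]] i
      unfolding X_def[symmetric] w_def[symmetric] using t1 by auto
    finally show ?thesis .
  qed
  show "U i $ 1 * w i = U i $ 1 + \<Delta>t / \<Delta>x * patankar N (mass_flux \<gamma> X) (mass_flux \<gamma> X) w i"
    by (rule eq[OF i])
  have "\<Delta>t / \<Delta>x \<ge> 0" using assms(2,3) by simp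
  moreover have "\<forall>i\<in>{1..N}. U i $ 1 > 0" using r by blast
  ultimately have sys: "\<exists>w. (\<forall>i\<in>{1..N}. U i $ 1 * w i = U i $ 1 + \<Delta>t / \<Delta>x * patankar N (mass_flux \<gamma> X) (mass_flux \<gamma> X) w i \<and> w i > 0) \<and>
    (\<forall>w'. (\<forall>i\<in>{1..N}. U i $ 1 * w' i = U i $ 1 + \<Delta>t / \<Delta>x * patankar N (mass_flux \<gamma> X) (mass_flux \<gamma> X) w' i) \<longrightarrow>
      (\<forall>i\<in>{1..N}. w' i = w i))"
    by (rule patankar_system[OF assms(1)])
  then obtain w0 where w0: "\<forall>i\<in>{1..N}. w0 i > 0"
    "(\<forall>i\<in>{1..N}. U i $ 1 * w i = U i $ 1 + \<Delta>t / \<Delta>x * patankar N (mass_flux \<gamma> X) (mass_flux \<gamma> X) w i)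
      \<longrightarrow> (\<forall>i\<in>{1..N}. w i = w0 i)"
    by blast
  have "\<forall>i\<in>{1..N}. w i = w0 i" by (rule mp[OF w0(2)]) (intro ballI eq)
  then show "w i > 0" using w0(1) i by simp
qed

text \<open>Once the weights are found from the density system, the remaining components are
  explicit. Uniqueness is claimed on the cells only, since the scheme leaves other values
  free.\<close>

lemma mpe_step_ex1:
  assumes "N \<ge> 2" "\<Delta>x > 0" "\<Delta>t > 0" "admissible \<gamma> N U"
  shows "\<exists>V. mpe_step \<gamma> N \<Delta>x GL GR \<Delta>t U V \<and>
             (\<forall>V'. mpe_step \<gamma> N \<Delta>x GL GR \<Delta>t U V' \<longrightarrow> (\<forall>i\<in>{1..N}. V' i = V i)) \<and>
             (\<forall>i\<in>{1..N}. V i $ 1 > 0)"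
proof -
  define X where "X = extend N GL GR U"
  have r: "U i $ 1 > 0" if "i \<in> {1..N}" for i
    using assms(4) that by (auto simp: admissible_def admissible_state_def rho_def)
  have "\<Delta>t / \<Delta>x \<ge> 0" using assms(2,3) by simp
  moreover have "\<forall>i\<in>{1..N}. U i $ 1 > 0" using r by blast
  ultimately have sys: "\<exists>w. (\<forall>i\<in>{1..N}. U i $ 1 * w i = U i $ 1 + \<Delta>t / \<Delta>x * patankar N (mass_flux \<gamma> X) (mass_flux \<gamma> X) w i \<and> w i > 0) \<and>
    (\<forall>w'. (\<forall>i\<in>{1..N}. U i $ 1 * w' i = U i $ 1 + \<Delta>t / \<Delta>x * patankar N (mass_flux \<gamma> X) (mass_flux \<gamma> X) w' i) \<longrightarrow>
      (\<forall>i\<in>{1..N}. w' i = w i))"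
    by (rule patankar_system[OF assms(1)])
  then obtain w where w: "\<forall>i\<in>{1..N}. U i $ 1 * w i = U i $ 1 + \<Delta>t / \<Delta>x * patankar N (mass_flux \<gamma> X) (mass_flux \<gamma> X) w i \<and> w i > 0"
    and w_unique: "\<forall>w'. (\<forall>i\<in>{1..N}. U i $ 1 * w' i = U i $ 1 + \<Delta>t / \<Delta>x * patankar N (mass_flux \<gamma> X) (mass_flux \<gamma> X) w' i)
      \<longrightarrow> (\<forall>i\<in>{1..N}. w' i = w i)"
    by blast
  \<comment> \<open>\<open>V\<close> is built from the solved weights \<open>w\<close>; it remains
    to check that its density ratios reproduce \<open>w\<close>.\<close>
  define V :: grid where "V i = (\<chi> k. U i $ k + \<Delta>t / \<Delta>x *
       (patankar N (mass_flux \<gamma> X) (conv_part \<gamma> X k) w i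
        + (pres_part \<gamma> X k (i - 1) - pres_part \<gamma> X k i)))" for i
  have t1: "conv_part \<gamma> X 1 = mass_flux \<gamma> X" "pres_part \<gamma> X 1 = (\<lambda>_. 0)"
    by (simp_all add: conv_part_def pres_part_def fun_eq_iff)
  have V1: "V i $ 1 = U i $ 1 * w i" if "i \<in> {1..N}" for i
    using w that by (simp add: V_def t1)
  have Vw: "V i $ 1 / U i $ 1 = w i" if "i \<in> {1..N}" for i
    using V1[OF that] r[OF that] by simp
  have 1: "mpe_step \<gamma> N \<Delta>x GL GR \<Delta>t U V"
    unfolding mpe_step_iff[OF assms(1)] X_def[symmetric]
  proof (intro ballI allI)
    fix i k assume i: "i \<in> {1..N}"
    show "V i $ k = U i $ k + \<Delta>t / \<Delta>x *
       (patankar N (mass_flux \<gamma> X) (conv_part \<gamma> X k) (\<lambda>i. V i $ 1 / U i $ 1) i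
        + (pres_part \<gamma> X k (i - 1) - pres_part \<gamma> X k i))"
      using patankar_cong[OF i Vw refl] by (simp add: V_def)
  qed
  have 2: "V' i = V i" if V': "mpe_step \<gamma> N \<Delta>x GL GR \<Delta>t U V'" and i: "i \<in> {1..N}" for V' i
  proof -
    have "\<forall>i\<in>{1..N}. V' i $ 1 / U i $ 1 = w i"
      by (rule w_unique[THEN spec, THEN mp])
         (intro ballI mpe_step_weights(1)[OF assms V', folded X_def])
    then have w': "V' i $ 1 / U i $ 1 = w i" if "i \<in> {1..N}" for i using that by blast
    show ?thesis
      using V'[unfolded mpe_step_iff[OF assms(1)] X_def[symmetric]] i patankar_cong[OF i w' refl]
      by (simp add: vec_eq_iff V_def)
  qed
  have 3: "V i $ 1 > 0" if "i \<in> {1..N}" for i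
    unfolding V1[OF that] using r[OF that] w that by (intro mult_pos_pos) auto
  from 1 2 3 show ?thesis by blast
qed

section \<open>Preservation of constant velocity and pressure\<close>

lemma pres_const_int_en:
  "\<gamma> > 1 \<Longrightarrow> pres \<gamma> U = pb \<longleftrightarrow> int_en U = pb / (\<gamma> - 1)"
  by (auto simp: pres_def field_simps)

text \<open>Momentum and energy change by fixed multiples of the density increment, so the velocity
  stays and the energy increment is purely kinetic.\<close>

lemma mpe_step_const_vel_pres:
  assumes "N \<ge> 2" "\<Delta>x > 0" "\<gamma> > 1" "\<Delta>t > 0" "admissible \<gamma> N U"
    and step: "mpe_step \<gamma> N \<Delta>x GL GR \<Delta>t U V"
    and cU: "const_vel_pres \<gamma> N ub pb U"
    and gh: "vel (GL U) = ub" "pres \<gamma> (GL U) = pb" "vel (GR U) = ub" "pres \<gamma> (GR U) = pb"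
  shows "const_vel_pres \<gamma> N ub pb V" and "\<And>i. i \<in> {1..N} \<Longrightarrow> rho (V i) > 0"
proof -
  define X where "X = extend N GL GR U"
  have vX: "vel (X i) = ub" and pX: "pres \<gamma> (X i) = pb" if "i \<le> N + 1" for i
    using that cU gh by (auto simp: X_def extend_def const_vel_pres_def)
  have eX: "int_en (X i) = pb / (\<gamma> - 1)" if "i \<le> N + 1" for i
    using pX[OF that] pres_const_int_en[OF \<open>\<gamma> > 1\<close>] by blast
  \<comment> \<open>Ratios of momentum and kinetic energy to density at velocity \<open>ub\<close>.
    The convective fluxes have the same ratios, in the averages and in the dissipation, as
    \<open>alpha\<close> is common to all components.\<close>
  define a :: "3 \<Rightarrow> real" where "a k = (if k = 1 then 1 else if k = 2 then ub else ub^2 / 2)" for k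
  have tr: "conv_part \<gamma> X k i = a k * mass_flux \<gamma> X i" if "i \<le> N" for i k
    using that by (auto simp: conv_part_def mass_flux_def a_def Fw_def Fhat_def avg_def jump_def
        flux_def vector_3 vX rho_def algebra_simps power2_eq_square power3_eq_cube)
  \<comment> \<open>Equal pressures and internal energies make the averages the same at every
    interface and the dissipation zero, so \<open>alpha\<close> may vary.\<close>
  have nt: "pres_part \<gamma> X k (i - 1) - pres_part \<gamma> X k i = 0" if "i \<in> {1..N}" for i k
    using that by (auto simp: pres_part_def Fu_def avg_def jump_def vX pX eX)
  define w where "w = (\<lambda>i. V i $ 1 / U i $ 1)"
  define P where "P = patankar N (mass_flux \<gamma> X) (mass_flux \<gamma> X) w"
  have pt: "patankar N (mass_flux \<gamma> X) (conv_part \<gamma> X k) w i = a k * P i" if "i \<in> {1..N}" for i k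
    unfolding P_def patankar_scale[symmetric] by (intro patankar_cong that tr refl)
  have V: "V i $ k = U i $ k + a k * (\<Delta>t / \<Delta>x * P i)" if "i \<in> {1..N}" for i k
    using step[unfolded mpe_step_iff[OF assms(1)] X_def[symmetric] w_def[symmetric]] that pt nt
    by auto
  have r: "U i $ 1 > 0" if "i \<in> {1..N}" for i
    using assms(5) that by (auto simp: admissible_def admissible_state_def rho_def)
  show rV: "rho (V i) > 0" if "i \<in> {1..N}" for i
    using mpe_step_weights(2)[OF assms(1,2,4-6) that] r[OF that] by (simp add: rho_def zero_less_divide_iff)
  show "const_vel_pres \<gamma> N ub pb V"
    unfolding const_vel_pres_def
  proof
    fix i assume i: "i \<in> {1..N}"
    define d where "d = \<Delta>t / \<Delta>x * P i"
    have V1: "V i $ 1 = U i $ 1 + d" using V[OF i, of 1] by (simp add: a_def d_def)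
    have vU: "vel (U i) = ub" using cU i by (auto simp: const_vel_pres_def)
    then have "U i $ 2 = ub * U i $ 1" using r[OF i] by (auto simp: vel_def)
    then have V2: "V i $ 2 = ub * V i $ 1" using V[OF i, of 2] V1 by (simp add: a_def d_def distrib_left)
    then have vV: "vel (V i) = ub" using rV[OF i] by (simp add: vel_def rho_def)
    have "V i $ 3 = U i $ 3 + ub^2 / 2 * d" using V[OF i, of 3] by (simp add: a_def d_def)
    \<comment> \<open>The kinetic energy changes by \<open>ub^2 / 2 * d\<close> too, since the
      velocity is unchanged.\<close>
    then have "int_en (V i) = int_en (U i)"
      using vV vU V1 by (simp add: int_en_def tot_en_def rho_def algebra_simps)
    then show "vel (V i) = ub \<and> pres \<gamma> (V i) = pb"
      using vV cU i by (auto simp: pres_def const_vel_pres_def)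
  qed
qed

section \<open>Convergence at a linear rate\<close>

text \<open>Convergence from the right with error \<open>O(h)\<close>. Absolute values and
  \<open>max\<close> in \<open>alpha\<close> leave the flux without a derivative in general, so this
  rate is propagated instead.\<close>

definition O_near :: "(real \<Rightarrow> real) \<Rightarrow> real \<Rightarrow> bool" where
  "O_near f c \<longleftrightarrow> (\<lambda>h. f h - c) \<in> O[at_right 0](\<lambda>h. h)"

lemma O_near_const: "O_near (\<lambda>_. c) c"
  by (simp add: O_near_def)

lemma O_near_add: "O_near f a \<Longrightarrow> O_near g b \<Longrightarrow> O_near (\<lambda>h. f h + g h) (a + b)"
  unfolding O_near_def by (drule (1) sum_in_bigo(1)) (simp add: algebra_simps)

lemma O_near_diff: "O_near f a \<Longrightarrow> O_near g b \<Longrightarrow> O_near (\<lambda>h. f h - g h) (a - b)"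
  unfolding O_near_def by (drule (1) sum_in_bigo(2)) (simp add: algebra_simps)

lemma O_near_sum:
  "(\<And>i. i \<in> A \<Longrightarrow> O_near (f i) (c i)) \<Longrightarrow> O_near (\<lambda>h. \<Sum>i\<in>A. f i h) (\<Sum>i\<in>A. c i)"
  by (induction A rule: infinite_finite_induct) (auto intro: O_near_add O_near_const)

lemma O_near_tendsto:
  assumes "O_near f c"
  shows "(f \<longlongrightarrow> c) (at_right 0)"
proof -
  obtain C where C: "eventually (\<lambda>h. norm (f h - c) \<le> C * norm h) (at_right 0)"
    using assms by (auto simp: O_near_def elim: landau_o.bigE)
  have "((\<lambda>h::real. C * norm h) \<longlongrightarrow> C * norm (0::real)) (at_right 0)"
    by (rule tendsto_mult_left[OF tendsto_norm[OF tendsto_ident_at]])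
  then have "((\<lambda>h. f h - c) \<longlongrightarrow> 0) (at_right 0)"
    using Lim_null_comparison[OF C] by simp
  then show ?thesis by (rule LIM_zero_cancel)
qed

lemma O_near_mult:
  assumes "O_near f a" "O_near g b"
  shows "O_near (\<lambda>h. f h * g h) (a * b)"
proof -
  have "f \<in> O[at_right 0](\<lambda>_. 1)"
    by (intro bigoI_tendsto[where c = a]) (use O_near_tendsto[OF assms(1)] in auto)
  then have "(\<lambda>h. f h * (g h - b)) \<in> O[at_right 0](\<lambda>h. 1 * h)"
    using assms(2) unfolding O_near_def by (rule landau_o.big.mult)
  moreover have "(\<lambda>h. (f h - a) * b) \<in> O[at_right 0](\<lambda>h. h)"
    using assms(1) by (cases "b = 0") (simp_all add: O_near_def)
  ultimately have "(\<lambda>h. f h * (g h - b) + (f h - a) * b) \<in> O[at_right 0](\<lambda>h. h)"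
    by (intro sum_in_bigo(1)) simp_all
  then show ?thesis by (simp add: O_near_def algebra_simps)
qed

lemma O_near_power: "O_near f a \<Longrightarrow> O_near (\<lambda>h. f h ^ n) (a ^ n)"
  by (induction n) (auto intro: O_near_const O_near_mult)

text \<open>A bounded difference quotient near \<open>c\<close> acts as a Lipschitz bound against
  \<open>c\<close> alone; the case \<open>f h = c\<close> is separate because the quotient then
  degenerates.\<close>

lemma O_near_deriv:
  assumes "O_near f c" and g: "(g has_real_derivative D) (at c)"
  shows "O_near (\<lambda>h. g (f h)) (g c)"
proof -
  from g have "((\<lambda>x. (g x - g c) / (x - c)) \<longlongrightarrow> D) (at c)"
    by (simp add: has_field_derivative_iff)
  then have "\<forall>\<^sub>F x in at c. dist ((g x - g c) / (x - c)) D < 1"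
    by (rule tendstoD) simp
  then have "\<forall>\<^sub>F x in nhds c. x \<noteq> c \<longrightarrow> dist ((g x - g c) / (x - c)) D < 1"
    by (simp add: eventually_at_filter)
  then have ev: "\<forall>\<^sub>F h in at_right 0. f h \<noteq> c \<longrightarrow> dist ((g (f h) - g c) / (f h - c)) D < 1"
    using O_near_tendsto[OF assms(1)] by (rule eventually_compose_filterlim)
  have "(\<lambda>h. g (f h) - g c) \<in> O[at_right 0](\<lambda>h. f h - c)"
  proof (rule landau_o.bigI[where c = "\<bar>D\<bar> + 1"])
    show "\<forall>\<^sub>F h in at_right 0. norm (g (f h) - g c) \<le> (\<bar>D\<bar> + 1) * norm (f h - c)"
      using ev
    proof eventually_elim
      case (elim h)
      show ?case
      proof (cases "f h = c")
        case False
        then have "\<bar>(g (f h) - g c) / (f h - c)\<bar> \<le> \<bar>D\<bar> + 1" using elim unfolding dist_real_def by linarith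
        then show ?thesis using False by (simp add: abs_divide divide_le_eq)
      qed simp
    qed
  qed simp
  then show ?thesis using assms(1) unfolding O_near_def by (rule landau_o.big_trans)
qed

lemma O_near_divide:
  assumes "O_near f a" "O_near g b" "b \<noteq> 0"
  shows "O_near (\<lambda>h. f h / g h) (a / b)"
  unfolding divide_inverse
  using assms by (intro O_near_mult O_near_deriv[OF assms(2) DERIV_inverse]) auto

lemma O_near_sqrt: "O_near f c \<Longrightarrow> c > 0 \<Longrightarrow> O_near (\<lambda>h. sqrt (f h)) (sqrt c)"
  by (rule O_near_deriv[OF _ DERIV_real_sqrt])

lemma O_near_abs: "O_near f c \<Longrightarrow> O_near (\<lambda>h. \<bar>f h\<bar>) \<bar>c\<bar>"
  unfolding O_near_def
  by (erule landau_o.big_trans[rotated], rule landau_o.big_mono) (simp add: abs_triangle_ineq3)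

lemma O_near_max:
  assumes "O_near f a" "O_near g b"
  shows "O_near (\<lambda>h. max (f h) (g h)) (max a b)"
proof -
  have max: "max x y = 1/2 * (x + y + \<bar>x - y\<bar>)" for x y :: real by (simp add: max_def)
  show ?thesis unfolding max
    by (intro O_near_mult O_near_const O_near_add O_near_abs O_near_diff assms)
qed

section \<open>One-sided derivatives and a Taylor bound\<close>

lemma at_within_Ico: "a < b \<Longrightarrow> at a within {a..<b} = at_right a"
  for a :: real
  by (rule at_within_nhd[where S = "{..<b}"]) auto

lemma O_near_has_derivative:
  fixes u :: "real \<Rightarrow> real"
  assumes "T > 0" "(u has_real_derivative D) (at t within {t..<t + T})"
  shows "O_near (\<lambda>h. u (t + h)) (u t)"
proof -
  have "((\<lambda>y. (u y - u t) / (y - t)) \<longlongrightarrow> D) (at_right t)"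
    using DERIV_subset[OF assms(2), of "{t..<t + T}"] assms(1)
    by (simp add: has_field_derivative_iff at_within_Ico)
  then have "((\<lambda>h. (u (t + h) - u t) / h) \<longlongrightarrow> D) (at_right 0)"
    by (subst (asm) at_right_to_0) (simp add: filterlim_filtermap add.commute)
  then show ?thesis unfolding O_near_def
    by (rule bigoI_tendsto) (auto simp: eventually_at_filter)
qed

text \<open>The mean value inequality for \<open>u\<close> minus its linear part yields one factor
  \<open>h\<close> from the length of the interval and another from the rate of \<open>u'\<close>,
  which replaces a bound on a second derivative.\<close>

lemma second_order_taylor_bound:
  fixes u u' :: "real \<Rightarrow> real"
  assumes "T > 0"
    and deriv: "\<And>s. s \<in> {t..<t + T} \<Longrightarrow> (u has_real_derivative u' s) (at s within {t..<t + T})"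
    and u': "O_near (\<lambda>h. u' (t + h)) (u' t)"
  shows "(\<lambda>h. u (t + h) - u t - h * u' t) \<in> O[at_right 0](\<lambda>h. h\<^sup>2)"
proof -
  obtain C where "C > 0" and C: "\<forall>\<^sub>F h in at_right 0. norm (u' (t + h) - u' t) \<le> C * norm h"
    using u' by (auto simp: O_near_def elim: landau_o.bigE)
  obtain \<eta> where "\<eta> > 0" and \<eta>: "\<And>h. 0 < h \<Longrightarrow> h < \<eta> \<Longrightarrow> \<bar>u' (t + h) - u' t\<bar> \<le> C * h"
    using C unfolding eventually_at_right_field by auto
  have bound: "\<bar>u (t + h) - u t - h * u' t\<bar> \<le> C * h\<^sup>2" if h: "0 < h" "h < min \<eta> T" for h
  proof -
    define g where "g s = u s - s * u' t" for s
    have "norm (g (t + h) - g t) \<le> (C * h) * norm (t + h - t)"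
    proof (rule field_differentiable_bound[where S = "{t..t + h}"])
      fix s assume s: "s \<in> {t..t + h}"
      have "(u has_real_derivative u' s) (at s within {t..t + h})"
        using s h by (intro DERIV_subset[OF deriv]) auto
      then show "(g has_real_derivative u' s - u' t) (at s within {t..t + h})"
        unfolding g_def by (auto intro!: derivative_eq_intros)
      show "norm (u' s - u' t) \<le> C * h"
      \<comment> \<open>\<open>\<eta>\<close> controls only strictly positive increments, so the
        left endpoint is treated on its own.\<close>
      proof (cases "s = t")
        case False
        then have "\<bar>u' s - u' t\<bar> \<le> C * (s - t)" using \<eta>[of "s - t"] s h by simp
        also have "\<dots> \<le> C * h" using s \<open>C > 0\<close> by simp
        finally show ?thesis by simp
      qed (use \<open>C > 0\<close> h in simp)
    qed (use h in auto)
    then show ?thesis using h by (simp add: g_def algebra_simps power2_eq_square)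
  qed
  show ?thesis
  proof (rule landau_o.bigI[OF \<open>C > 0\<close>])
    show "\<forall>\<^sub>F h in at_right 0. norm (u (t + h) - u t - h * u' t) \<le> C * norm (h\<^sup>2)"
      unfolding eventually_at_right_field
      using bound \<open>\<eta> > 0\<close> \<open>T > 0\<close> by (intro exI[of _ "min \<eta> T"]) auto
  qed
qed

section \<open>Regularity of the numerical flux\<close>

lemma admissible_state_iff_int_en:
  "\<gamma> > 1 \<Longrightarrow> admissible_state \<gamma> U \<longleftrightarrow> rho U > 0 \<and> int_en U > 0"
  by (auto simp: admissible_state_def pres_def zero_less_mult_iff)

lemma int_en_eq: "rho U \<noteq> 0 \<Longrightarrow> int_en U = U $ 3 - (U $ 2)\<^sup>2 / (2 * U $ 1)"
  by (simp add: int_en_def tot_en_def vel_def rho_def field_simps power2_eq_square)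

text \<open>The internal energy is superadditive where the density is positive, because
  \<open>m\<^sup>2 / \<rho>\<close> is jointly convex and homogeneous.\<close>

lemma admissible_state_avg:
  assumes "\<gamma> > 1" "admissible_state \<gamma> (X i)" "admissible_state \<gamma> (X (i + 1))"
  shows "admissible_state \<gamma> (avg X i)"
proof -
  define a b m n E F where ab: "a = X i $ 1" "b = X (i + 1) $ 1" "m = X i $ 2" "n = X (i + 1) $ 2"
    "E = X i $ 3" "F = X (i + 1) $ 3"
  have pos: "a > 0" "b > 0" and en: "m\<^sup>2 / (2 * a) < E" "n\<^sup>2 / (2 * b) < F"
    using assms by (auto simp: admissible_state_iff_int_en int_en_eq) (auto simp: rho_def ab)
  have en2: "m\<^sup>2 / a < 2 * E" "n\<^sup>2 / b < 2 * F" using en pos by (simp_all add: field_simps)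
  \<comment> \<open>Cauchy-Schwarz in Engel form: the defect is an explicit square over a positive
    denominator.\<close>
  have "m\<^sup>2 / a + n\<^sup>2 / b - (m + n)\<^sup>2 / (a + b) = (m * b - n * a)\<^sup>2 / (a * b * (a + b))"
    using pos by (simp add: divide_simps) algebra
  also have "\<dots> \<ge> 0" using pos by simp
  finally have "(m + n)\<^sup>2 / (a + b) < 2 * E + 2 * F" using en2 by linarith
  then obtain q where q: "q = (m + n)\<^sup>2 / (a + b)" "q < 2 * E + 2 * F" by blast
  \<comment> \<open>\<open>q / 4\<close> is the kinetic energy of the averaged state.\<close>
  have "((m + n) / 2)\<^sup>2 / (2 * ((a + b) / 2)) = q / 4"
    using pos q(1) by (simp add: field_simps power2_eq_square)
  with q(2) have main: "(E + F) / 2 - ((m + n) / 2)\<^sup>2 / (2 * ((a + b) / 2)) > 0" by (simp add: field_simps)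
  have comps: "avg X i $ 1 = (a + b) / 2" "avg X i $ 2 = (m + n) / 2" "avg X i $ 3 = (E + F) / 2"
    by (simp_all add: avg_def ab)
  have rho: "rho (avg X i) > 0" using pos by (simp add: rho_def comps)
  then have "rho (avg X i) \<noteq> 0" by simp
  then have "int_en (avg X i) > 0" using main by (simp only: int_en_eq comps not_False_eq_True)
  with rho show ?thesis using assms(1) by (simp add: admissible_state_iff_int_en)
qed

definition O_near_state :: "(real \<Rightarrow> state) \<Rightarrow> state \<Rightarrow> bool" where
  "O_near_state X Y \<longleftrightarrow> (\<forall>k. O_near (\<lambda>h. X h $ k) (Y $ k))"

lemma O_near_rho: "O_near_state X Y \<Longrightarrow> O_near (\<lambda>h. rho (X h)) (rho Y)"
  by (simp add: O_near_state_def rho_def)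

lemma O_near_tot_en: "O_near_state X Y \<Longrightarrow> O_near (\<lambda>h. tot_en (X h)) (tot_en Y)"
  by (simp add: O_near_state_def tot_en_def)

context
  fixes X :: "real \<Rightarrow> state" and Y :: state and \<gamma> :: real
  assumes XY: "O_near_state X Y" and Y: "admissible_state \<gamma> Y"
begin

lemma O_near_vel: "O_near (\<lambda>h. vel (X h)) (vel Y)"
  unfolding vel_def using XY Y
  by (intro O_near_divide) (auto simp: O_near_state_def admissible_state_def rho_def)

lemma O_near_int_en: "O_near (\<lambda>h. int_en (X h)) (int_en Y)"
  unfolding int_en_def
  by (intro O_near_diff O_near_mult O_near_power O_near_const O_near_vel O_near_rho O_near_tot_en XY)

lemma O_near_pres: "O_near (\<lambda>h. pres \<gamma> (X h)) (pres \<gamma> Y)"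
  unfolding pres_def by (intro O_near_mult O_near_const O_near_int_en)

text \<open>The square root is not Lipschitz at 0; admissibility of \<open>Y\<close> with
  \<open>\<gamma> > 1\<close> keeps the radicand positive.\<close>

lemma O_near_sound: "\<gamma> > 1 \<Longrightarrow> O_near (\<lambda>h. sound \<gamma> (X h)) (sound \<gamma> Y)"
  unfolding sound_def using Y
  by (intro O_near_sqrt O_near_divide O_near_mult O_near_const O_near_pres O_near_rho XY)
     (auto simp: admissible_state_def)

lemma O_near_flux: "O_near_state (\<lambda>h. flux \<gamma> (X h)) (flux \<gamma> Y)"
  unfolding O_near_state_def forall_3 flux_def vector_3
  by (intro conjI O_near_add O_near_mult O_near_power O_near_vel O_near_rho O_near_pres O_near_tot_en XY)

end

lemma O_near_Fhat:
  assumes "\<gamma> > 1"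
    and X: "\<And>j. j \<in> {i, i + 1} \<Longrightarrow> O_near_state (\<lambda>h. X h j) (Y j)"
    and Y: "\<And>j. j \<in> {i, i + 1} \<Longrightarrow> admissible_state \<gamma> (Y j)"
  shows "O_near (\<lambda>h. Fhat \<gamma> (X h) i $ k) (Fhat \<gamma> Y i $ k)"
proof -
  have avg: "O_near_state (\<lambda>h. avg (X h) i) (avg Y i)"
    unfolding O_near_state_def
  proof
    fix k show "O_near (\<lambda>h. avg (X h) i $ k) (avg Y i $ k)"
      using X unfolding avg_def vector_scaleR_component vector_add_component real_scaleR_def
      by (intro O_near_mult O_near_const O_near_add) (auto simp: O_near_state_def)
  qed
  \<comment> \<open>\<open>alpha\<close> takes the sound speed at the averaged state, so the
    radicand there must be positive as well.\<close>
  have Yavg: "admissible_state \<gamma> (avg Y i)"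
    by (intro admissible_state_avg assms) auto
  have Max3: "Max {x, y, z} = max x (max y z)" for x y z :: real by simp
  have alpha: "O_near (\<lambda>h. alpha \<gamma> (X h) i) (alpha \<gamma> Y i)"
    unfolding alpha_def Max3 avg_def[where ?g = "\<lambda>j. vel (_ j)"] real_scaleR_def
    by (intro O_near_max O_near_add O_near_abs O_near_mult O_near_const
        O_near_vel[OF _ Y] O_near_sound[OF _ Y] O_near_sound[OF avg Yavg] X assms(1)) auto
  show ?thesis
    unfolding Fhat_def avg_def jump_def vector_scaleR_component vector_add_component
      vector_minus_component real_scaleR_def
    using O_near_flux[OF X Y] X
    by (intro O_near_diff O_near_mult O_near_add O_near_const O_near_divide alpha)
       (auto simp: O_near_state_def)
qed

section \<open>Order of accuracy\<close>

lemma O_near_patankar: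
  assumes "i \<in> {1..N}" "\<And>j. j \<in> {1..N} \<Longrightarrow> O_near (\<lambda>h. w h j) (v j)"
  shows "O_near (\<lambda>h. patankar N F G (w h) i) (patankar N F G v i)"
  unfolding patankar_def using assms
  by (intro O_near_add O_near_diff O_near_mult O_near_sum O_near_const) auto

text \<open>Boundary outflow only lowers the sum of the densities, so no cell can exceed the old sum
  plus the inflow; \<open>\<Delta>t \<le> 1\<close> makes the bound independent of the step
  size.\<close>

lemma mpe_step_weights_le:
  fixes U V :: grid and GL GR :: "grid \<Rightarrow> state"
  assumes "N \<ge> 2" "\<Delta>x > 0" "0 < \<Delta>t" "\<Delta>t \<le> 1" "admissible \<gamma> N U"
    and "mpe_step \<gamma> N \<Delta>x GL GR \<Delta>t U V" and i: "i \<in> {1..N}"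
  shows "V i $ 1 / U i $ 1
    \<le> ((\<Sum>j=1..N. U j $ 1) + (\<Sum>j=1..N. inflow N (mass_flux \<gamma> (extend N GL GR U)) (mass_flux \<gamma> (extend N GL GR U)) j) / \<Delta>x) / U i $ 1"
proof -
  define F where "F = mass_flux \<gamma> (extend N GL GR U)"
  define w where "w = (\<lambda>i. V i $ 1 / U i $ 1)"
  have r: "U i $ 1 > 0" if "i \<in> {1..N}" for i
    using assms(5) that by (auto simp: admissible_def admissible_state_def rho_def)
  have eq: "U i $ 1 * w i = U i $ 1 + \<Delta>t / \<Delta>x * patankar N F F w i" and w: "w i > 0" if "i \<in> {1..N}" for i
    using mpe_step_weights[OF assms(1-3,5,6) that] by (simp_all only: F_def w_def)
  have "U i $ 1 * w i \<le> (\<Sum>j=1..N. U j $ 1 * w j)"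
    using i r w by (intro member_le_sum[of i "{1..N}" "\<lambda>j. U j $ 1 * w j"]) (auto intro!: less_imp_le mult_pos_pos)
  also have "\<dots> = (\<Sum>j=1..N. U j $ 1 + \<Delta>t / \<Delta>x * patankar N F F w j)"
    by (intro sum.cong refl eq)
  also have "\<dots> = (\<Sum>j=1..N. U j $ 1) + \<Delta>t / \<Delta>x * (\<Sum>j=1..N. patankar N F F w j)"
    by (simp only: sum.distrib sum_distrib_left)
  also have "\<dots> \<le> (\<Sum>j=1..N. U j $ 1) + \<Delta>t / \<Delta>x * (\<Sum>j=1..N. inflow N F F j)"
    using assms w by (intro add_left_mono mult_left_mono sum_patankar_le) (auto intro: less_imp_le)
  also have "\<dots> \<le> (\<Sum>j=1..N. U j $ 1) + 1 / \<Delta>x * (\<Sum>j=1..N. inflow N F F j)"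
    using assms(1-4) by (intro add_left_mono mult_right_mono sum_nonneg inflow_nonneg divide_right_mono) auto
  finally have "U i $ 1 * w i \<le> (\<Sum>j=1..N. U j $ 1) + (\<Sum>j=1..N. inflow N F F j) / \<Delta>x" by simp
  then have "w i \<le> ((\<Sum>j=1..N. U j $ 1) + (\<Sum>j=1..N. inflow N F F j) / \<Delta>x) / U i $ 1"
    using r[OF i] by (simp add: pos_le_divide_eq mult.commute)
  then show ?thesis by (simp only: w_def F_def)
qed

text \<open>The weight equation expresses \<open>w - 1\<close> as \<open>h\<close> times an affine
  expression in the weights, whose boundedness gives the rate.\<close>

lemma mpe_step_O_near_weights:
  fixes U :: grid and V :: "real \<Rightarrow> grid" and GL GR :: "grid \<Rightarrow> state"
  assumes "N \<ge> 2" "\<Delta>x > 0" "admissible \<gamma> N U"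
    and step: "\<And>h. h > 0 \<Longrightarrow> mpe_step \<gamma> N \<Delta>x GL GR h U (V h)"
    and i: "i \<in> {1..N}"
  shows "O_near (\<lambda>h. V h i $ 1 / U i $ 1) 1"
proof -
  define F where "F = mass_flux \<gamma> (extend N GL GR U)"
  define w where "w h = (\<lambda>i. V h i $ 1 / U i $ 1)" for h
  define M where "M i = ((\<Sum>j=1..N. U j $ 1) + (\<Sum>j=1..N. inflow N F F j) / \<Delta>x) / U i $ 1" for i
  have r: "U i $ 1 > 0" if "i \<in> {1..N}" for i
    using assms(3) that by (auto simp: admissible_def admissible_state_def rho_def)
  have ev1: "\<forall>\<^sub>F h in at_right 0. h \<in> {0<..<1::real}"
    using eventually_at_right_real[of 0 "1::real"] by simp
  have bdd: "(\<lambda>h. w h j) \<in> O[at_right 0](\<lambda>_. 1)" if "j \<in> {1..N}" for j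
  proof (rule bigoI[where c = "M j"], use ev1 in eventually_elim)
    case (elim h)
    then have h: "h > 0" "h \<le> 1" by auto
    show ?case
      using mpe_step_weights_le[OF assms(1,2) h assms(3) step[OF h(1)] that]
        mpe_step_weights(2)[OF assms(1,2) h(1) assms(3) step[OF h(1)] that]
      by (simp add: w_def M_def F_def)
  qed
  have cbdd: "(\<lambda>h. c * w h j) \<in> O[at_right 0](\<lambda>_. 1)" if "j \<in> {1..N}" for j c
    using landau_o.big.mult[OF bigo_const bdd[OF that], of c] by simp
  have "(\<lambda>h. patankar N F F (w h) i) \<in> O[at_right 0](\<lambda>_. 1)"
    unfolding patankar_def by (intro sum_in_bigo big_sum_in_bigo bigo_const cbdd i)
  then have "(\<lambda>h. h * (1 / (\<Delta>x * U i $ 1) * patankar N F F (w h) i)) \<in> O[at_right 0](\<lambda>h. h * (1 * 1))"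
    by (intro landau_o.big.mult) simp_all
  moreover have "\<forall>\<^sub>F h in at_right 0. h * (1 / (\<Delta>x * U i $ 1) * patankar N F F (w h) i) = w h i - 1"
    using ev1
  proof eventually_elim
    case (elim h)
    then have h: "h > 0" by simp
    have "U i $ 1 * w h i = U i $ 1 + h / \<Delta>x * patankar N F F (w h) i"
      using mpe_step_weights(1)[OF assms(1,2) h assms(3) step[OF h] i] by (simp only: w_def F_def)
    then have "U i $ 1 * (w h i - 1) = h / \<Delta>x * patankar N F F (w h) i"
      by (simp only: right_diff_distrib)
    then have "w h i - 1 = h / \<Delta>x * patankar N F F (w h) i / U i $ 1"
      using r[OF i] by (metis less_irrefl nonzero_mult_div_cancel_left)
    then show ?case by simp
  qed
  ultimately have "(\<lambda>h. w h i - 1) \<in> O[at_right 0](\<lambda>h. h * (1 * 1))"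
    by (rule landau_o.big.in_cong[THEN iffD1, rotated])
  then show ?thesis by (simp add: O_near_def w_def)
qed

text \<open>With weights 1 the step is explicit Euler; weights off by \<open>O(h)\<close> alter the
  increment, which carries a factor \<open>h\<close>, by \<open>O(h\<^sup>2)\<close> only.\<close>

lemma mpe_step_expansion:
  fixes U :: grid and V :: "real \<Rightarrow> grid" and GL GR :: "grid \<Rightarrow> state"
  assumes "N \<ge> 2" "\<Delta>x > 0" "admissible \<gamma> N U"
    and gh: "admissible_state \<gamma> (GL U)" "admissible_state \<gamma> (GR U)"
    and step: "\<And>h. h > 0 \<Longrightarrow> mpe_step \<gamma> N \<Delta>x GL GR h U (V h)"
    and i: "i \<in> {1..N}"
  shows "(\<lambda>h. V h i $ k - U i $ k - h * semidiscrete_rhs \<gamma> N \<Delta>x GL GR U i $ k)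
    \<in> O[at_right 0](\<lambda>h. h\<^sup>2)"
proof -
  define X where "X = extend N GL GR U"
  define w where "w h = (\<lambda>i. V h i $ 1 / U i $ 1)" for h
  define F where "F = mass_flux \<gamma> X"
  define G where "G = conv_part \<gamma> X k"
  have rX: "rho (X j) \<noteq> 0" if "j \<le> N + 1" for j
  proof -
    have "admissible_state \<gamma> (X j)"
      using that assms(3) gh by (auto simp: X_def extend_def admissible_def)
    then show ?thesis by (simp add: admissible_state_def)
  qed
  have "O_near (\<lambda>h. patankar N F G (w h) i) (patankar N F G (\<lambda>_. 1) i)"
    unfolding w_def
    by (intro O_near_patankar i mpe_step_O_near_weights[OF assms(1-3) step]) simp_all
  then have "(\<lambda>h. h * (1 / \<Delta>x * (patankar N F G (w h) i - (G (i - 1) - G i)))) \<in> O[at_right 0](\<lambda>h. h * (1 * h))"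
    unfolding O_near_def patankar_unit_weights[OF assms(1) i]
    by (intro landau_o.big.mult) simp_all
  moreover have "\<forall>\<^sub>F h in at_right 0. h * (1 / \<Delta>x * (patankar N F G (w h) i - (G (i - 1) - G i)))
      = V h i $ k - U i $ k - h * semidiscrete_rhs \<gamma> N \<Delta>x GL GR U i $ k"
    using eventually_at_right_less[of "0::real"]
  proof eventually_elim
    case (elim h)
    have "semidiscrete_rhs \<gamma> N \<Delta>x GL GR U i $ k =
        1 / \<Delta>x * ((G (i - 1) + pres_part \<gamma> X k (i - 1)) - (G i + pres_part \<gamma> X k i))"
      unfolding semidiscrete_rhs_def G_def X_def[symmetric]
      using rX i by (subst (1 2) conv_part_add_pres_part) auto
    moreover have "V h i $ k = U i $ k + h / \<Delta>x *
       (patankar N F G (w h) i + (pres_part \<gamma> X k (i - 1) - pres_part \<gamma> X k i))"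
      using step[OF elim, unfolded mpe_step_iff[OF assms(1)]] i
      unfolding w_def F_def G_def X_def by blast
    ultimately show ?case
      by (simp only:) (simp add: algebra_simps add_divide_distrib diff_divide_distrib)
  qed
  ultimately have "(\<lambda>h. V h i $ k - U i $ k - h * semidiscrete_rhs \<gamma> N \<Delta>x GL GR U i $ k)
    \<in> O[at_right 0](\<lambda>h. h * (1 * h))"
    by (rule landau_o.big.in_cong[THEN iffD1, rotated])
  then show ?thesis by (simp add: power2_eq_square)
qed

section \<open>Ghost states and expansion of the semi-discrete solution\<close>

lemma ghost_map_lipschitz:
  assumes "ghost_map \<gamma> N G" "admissible \<gamma> N U"
  obtains \<epsilon> L where "\<epsilon> > 0"
    and "\<forall>V W. admissible \<gamma> N V \<and> (\<forall>i\<in>{1..N}. dist (V i) (U i) < \<epsilon>) \<and>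
           admissible \<gamma> N W \<and> (\<forall>i\<in>{1..N}. dist (W i) (U i) < \<epsilon>) \<longrightarrow>
           dist (G V) (G W) \<le> L * (\<Sum>i=1..N. dist (V i) (W i))"
  using assms(1)[unfolded ghost_map_def, THEN conjunct2, rule_format, OF assms(2)]
  by (elim exE conjE)

text \<open>The two grid functions have distance zero over the cells, so the local Lipschitz bound
  forces equal ghost values.\<close>

lemma ghost_map_cong:
  assumes "ghost_map \<gamma> N G" "admissible \<gamma> N U" "\<And>i. i \<in> {1..N} \<Longrightarrow> V i = U i"
  shows "G V = G U"
proof -
  obtain \<epsilon> L where "\<epsilon> > 0" and L: "\<forall>V W. admissible \<gamma> N V \<and> (\<forall>i\<in>{1..N}. dist (V i) (U i) < \<epsilon>) \<and>
           admissible \<gamma> N W \<and> (\<forall>i\<in>{1..N}. dist (W i) (U i) < \<epsilon>) \<longrightarrow>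
           dist (G V) (G W) \<le> L * (\<Sum>i=1..N. dist (V i) (W i))"
    by (rule ghost_map_lipschitz[OF assms(1,2)])
  have "admissible \<gamma> N V" using assms(2,3) by (simp add: admissible_def)
  then have "dist (G V) (G U) \<le> L * (\<Sum>i=1..N. dist (V i) (U i))"
    using assms(2,3) \<open>\<epsilon> > 0\<close> by (intro L[rule_format]) auto
  also have "\<dots> = 0" using assms(3) by simp
  finally show ?thesis by simp
qed

lemma dist_le_sum_components: "dist x y \<le> (\<Sum>k\<in>UNIV. \<bar>x $ k - y $ k\<bar>)" for x y :: "real ^ 'n"
  using norm_le_l1_cart[of "x - y"] by (simp add: dist_norm)

text \<open>Near \<open>Y\<close> the ghost map is Lipschitz, and for small \<open>h\<close> the
  values \<open>U h\<close> are admissible and within \<open>\<epsilon>\<close>, so the rate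
  \<open>O(h)\<close> carries over.\<close>

lemma O_near_state_ghost:
  fixes U :: "real \<Rightarrow> grid"
  assumes G: "ghost_map \<gamma> N G" and adm: "admissible \<gamma> N Y"
    and U: "\<And>i. i \<in> {1..N} \<Longrightarrow> O_near_state (\<lambda>h. U h i) (Y i)"
  shows "O_near_state (\<lambda>h. G (U h)) (G Y)"
proof -
  obtain \<epsilon> L where "\<epsilon> > 0" and L: "\<forall>V W. admissible \<gamma> N V \<and> (\<forall>i\<in>{1..N}. dist (V i) (Y i) < \<epsilon>) \<and>
           admissible \<gamma> N W \<and> (\<forall>i\<in>{1..N}. dist (W i) (Y i) < \<epsilon>) \<longrightarrow>
           dist (G V) (G W) \<le> L * (\<Sum>i=1..N. dist (V i) (W i))"
    by (rule ghost_map_lipschitz[OF G adm])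
  \<comment> \<open>An l1 distance on the grid that dominates every cell distance and is built from
    operations preserving linear rates.\<close>
  define d where "d h = (\<Sum>i=1..N. \<Sum>k\<in>UNIV. \<bar>U h i $ k - Y i $ k\<bar>)" for h
  have "O_near d (\<Sum>i=1..N. \<Sum>k\<in>UNIV. \<bar>Y i $ k - Y i $ k\<bar>)"
    unfolding d_def using U
    by (intro O_near_sum O_near_abs O_near_diff O_near_const) (auto simp: O_near_state_def)
  then have d: "O_near d 0" by simp
  have sumd: "(\<Sum>i=1..N. dist (U h i) (Y i)) \<le> d h" for h
    unfolding d_def by (intro sum_mono dist_le_sum_components)
  have distd: "dist (U h i) (Y i) \<le> d h" if "i \<in> {1..N}" for h i
    using that by (intro order.trans[OF member_le_sum sumd]) auto
  have "\<forall>\<^sub>F h in at_right 0. admissible_state \<gamma> (U h i)" if i: "i \<in> {1..N}" for i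
  proof -
    have Yi: "admissible_state \<gamma> (Y i)" using adm i by (simp add: admissible_def)
    then have "\<forall>\<^sub>F h in at_right 0. rho (U h i) > 0" "\<forall>\<^sub>F h in at_right 0. pres \<gamma> (U h i) > 0"
      using order_tendstoD(1)[OF O_near_tendsto[OF O_near_rho[OF U[OF i]]], of 0]
        order_tendstoD(1)[OF O_near_tendsto[OF O_near_pres[OF U[OF i] Yi]], of 0]
      by (auto simp: admissible_state_def)
    then show ?thesis by eventually_elim (simp add: admissible_state_def)
  qed
  then have ev_adm: "\<forall>\<^sub>F h in at_right 0. admissible \<gamma> N (U h)"
    unfolding admissible_def by (intro eventually_ball_finite) auto
  have ev_d: "\<forall>\<^sub>F h in at_right 0. d h < \<epsilon>"
    using order_tendstoD(2)[OF O_near_tendsto[OF d]] \<open>\<epsilon> > 0\<close> by blast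
  show ?thesis unfolding O_near_state_def
  proof
    fix k
    have "(\<lambda>h. G (U h) $ k - G Y $ k) \<in> O[at_right 0](d)"
    proof (rule bigoI[where c = "\<bar>L\<bar>"], use ev_adm ev_d in eventually_elim)
      case (elim h)
      have "norm (G (U h) $ k - G Y $ k) \<le> dist (G (U h)) (G Y)"
        using component_le_norm_cart[of "G (U h) - G Y" k] by (simp add: dist_norm)
      also have "\<dots> \<le> L * (\<Sum>i=1..N. dist (U h i) (Y i))"
        using elim(1) adm le_less_trans[OF distd elim(2)] \<open>\<epsilon> > 0\<close> by (intro L[rule_format]) auto
      \<comment> \<open>The sign of \<open>L\<close> is not prescribed, hence the passage to
        \<open>\<bar>L\<bar>\<close>.\<close>
      also have "\<dots> \<le> \<bar>L\<bar> * (\<Sum>i=1..N. dist (U h i) (Y i))"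
        by (intro mult_right_mono sum_nonneg) auto
      also have "\<dots> \<le> \<bar>L\<bar> * norm (d h)"
        using sumd[of h] by (intro mult_left_mono) auto
      finally show ?case .
    qed
    then show "O_near (\<lambda>h. G (U h) $ k) (G Y $ k)"
      using d unfolding O_near_def by (auto intro: landau_o.big_trans)
  qed
qed

lemma O_near_semidiscrete_rhs:
  fixes U :: "real \<Rightarrow> grid"
  assumes "\<gamma> > 1" "ghost_map \<gamma> N GL" "ghost_map \<gamma> N GR" and adm: "admissible \<gamma> N Y"
    and U: "\<And>i. i \<in> {1..N} \<Longrightarrow> O_near_state (\<lambda>h. U h i) (Y i)" and i: "i \<in> {1..N}"
  shows "O_near (\<lambda>h. semidiscrete_rhs \<gamma> N \<Delta>x GL GR (U h) i $ k)
    (semidiscrete_rhs \<gamma> N \<Delta>x GL GR Y i $ k)"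
proof -
  have X: "O_near_state (\<lambda>h. extend N GL GR (U h) j) (extend N GL GR Y j)" if "j \<le> N + 1" for j
    using that U O_near_state_ghost[OF assms(2) adm U] O_near_state_ghost[OF assms(3) adm U]
    by (auto simp: extend_def)
  have Y: "admissible_state \<gamma> (extend N GL GR Y j)" if "j \<le> N + 1" for j
    using that adm assms(2,3) by (auto simp: extend_def admissible_def ghost_map_def)
  have "O_near (\<lambda>h. Fhat \<gamma> (extend N GL GR (U h)) j $ k) (Fhat \<gamma> (extend N GL GR Y) j $ k)" if "j \<le> N" for j
    using that by (intro O_near_Fhat assms(1) X Y) auto
  then show ?thesis
    unfolding semidiscrete_rhs_def vector_scaleR_component vector_minus_component real_scaleR_def
    using i by (intro O_near_mult O_near_diff O_near_const) auto
qed

text \<open>Two stages: differentiability gives the solution a linear rate at \<open>t\<close>; the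
  regularity of the flux passes it on to the time derivative, and the Taylor bound then
  applies.\<close>

lemma semidiscrete_solution_expansion:
  assumes "\<gamma> > 1" "ghost_map \<gamma> N GL" "ghost_map \<gamma> N GR" "T > 0"
    and adm: "admissible \<gamma> N (U t)"
    and sol: "semidiscrete_solution \<gamma> N \<Delta>x GL GR {t..<t + T} U" and i: "i \<in> {1..N}"
  shows "(\<lambda>h. U (t + h) i $ k - U t i $ k - h * semidiscrete_rhs \<gamma> N \<Delta>x GL GR (U t) i $ k)
    \<in> O[at_right 0](\<lambda>h. h\<^sup>2)"
proof -
  have deriv: "((\<lambda>s. U s i $ k) has_real_derivative semidiscrete_rhs \<gamma> N \<Delta>x GL GR (U s) i $ k)
      (at s within {t..<t + T})" if "s \<in> {t..<t + T}" "i \<in> {1..N}" for s i k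
  proof -
    have "((\<lambda>s. U s i) has_vector_derivative semidiscrete_rhs \<gamma> N \<Delta>x GL GR (U s) i) (at s within {t..<t + T})"
      using sol that by (simp add: semidiscrete_solution_def)
    from bounded_linear.has_vector_derivative[OF bounded_linear_vec_nth this, of k]
    show ?thesis by (simp add: has_real_derivative_iff_has_vector_derivative)
  qed
  have "O_near_state (\<lambda>h. U (t + h) j) (U t j)" if "j \<in> {1..N}" for j
    unfolding O_near_state_def
    using O_near_has_derivative[OF \<open>T > 0\<close> deriv[OF _ that]] \<open>T > 0\<close> by simp
  then have "O_near (\<lambda>h. semidiscrete_rhs \<gamma> N \<Delta>x GL GR (U (t + h)) i $ k)
      (semidiscrete_rhs \<gamma> N \<Delta>x GL GR (U t) i $ k)"
    by (intro O_near_semidiscrete_rhs assms)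
  then show ?thesis
    using second_order_taylor_bound[where u = "\<lambda>s. U s i $ k" and t = t
        and u' = "\<lambda>s. semidiscrete_rhs \<gamma> N \<Delta>x GL GR (U s) i $ k"] deriv i \<open>T > 0\<close>
    by blast
qed

text \<open>Scheme and exact solution share their expansion up to the linear term, so only the two
  quadratic remainders are left in each component.\<close>

lemma first_order_accurate_mpe:
  assumes "N \<ge> 2" "\<Delta>x > 0" "\<gamma> > 1" and gh: "ghost_map \<gamma> N GL" "ghost_map \<gamma> N GR"
  shows "first_order_accurate \<gamma> N \<Delta>x GL GR"
  unfolding first_order_accurate_def
proof (intro allI impI ballI, elim conjE)
  fix Uo :: grid and U V :: "real \<Rightarrow> grid" and tn T :: real and i
  assume adm: "admissible \<gamma> N Uo" and "T > 0"
    and sol: "semidiscrete_solution \<gamma> N \<Delta>x GL GR {tn..<tn + T} U"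
    and init: "\<forall>i\<in>{1..N}. U tn i = Uo i"
    and step: "\<forall>\<Delta>t>0. mpe_step \<gamma> N \<Delta>x GL GR \<Delta>t Uo (V \<Delta>t)" and i: "i \<in> {1..N}"
  have admU: "admissible \<gamma> N (U tn)" using adm init by (simp add: admissible_def)
  have admG: "admissible_state \<gamma> (GL Uo)" "admissible_state \<gamma> (GR Uo)"
    using gh adm by (simp_all add: ghost_map_def)
  \<comment> \<open>The data agree on the cells only, so equality of the ghost states, and then of
    the fluxes, has to be derived.\<close>
  have "extend N GL GR (U tn) j = extend N GL GR Uo j" if "j \<le> N + 1" for j
    using that init ghost_map_cong[OF gh(1) adm, of "U tn"] ghost_map_cong[OF gh(2) adm, of "U tn"]
    by (auto simp: extend_def)
  then have "Fhat \<gamma> (extend N GL GR (U tn)) j = Fhat \<gamma> (extend N GL GR Uo) j" if "j \<le> N" for j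
    using that by (simp add: Fhat_def avg_def jump_def alpha_def)
  from this[of "i - 1"] this[of i]
  have rhs: "semidiscrete_rhs \<gamma> N \<Delta>x GL GR (U tn) i = semidiscrete_rhs \<gamma> N \<Delta>x GL GR Uo i"
    using i by (force simp: semidiscrete_rhs_def)
  have "(\<lambda>h. V h i $ k - U (tn + h) i $ k) \<in> O[at_right 0](\<lambda>h. h\<^sup>2)" for k
  proof -
    have "(\<lambda>h. (V h i $ k - Uo i $ k - h * semidiscrete_rhs \<gamma> N \<Delta>x GL GR Uo i $ k)
        - (U (tn + h) i $ k - U tn i $ k - h * semidiscrete_rhs \<gamma> N \<Delta>x GL GR (U tn) i $ k))
        \<in> O[at_right 0](\<lambda>h. h\<^sup>2)"
      by (rule sum_in_bigo(2)[OF
            mpe_step_expansion[OF assms(1,2) adm admG step[rule_format] i]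
            semidiscrete_solution_expansion[OF assms(3) gh \<open>T > 0\<close> admU sol i]])
    then show ?thesis using init i by (simp add: rhs)
  qed
  then have "(\<lambda>h. \<Sum>k\<in>UNIV. \<bar>V h i $ k - U (tn + h) i $ k\<bar>) \<in> O[at_right 0](\<lambda>h. h\<^sup>2)"
    by (intro big_sum_in_bigo) simp
  then show "(\<lambda>h. norm (V h i - U (tn + h) i)) \<in> O[at_right 0](\<lambda>h. h\<^sup>2)"
    using norm_le_l1_cart[of "V _ i - U _ i"]
    by (elim landau_o.big_trans[rotated], intro landau_o.big_mono) (auto simp: abs_of_nonneg sum_nonneg)
qed

section \<open>Iterated steps and the three claims together\<close>

lemma mpe_iterates_const_vel_pres:
  fixes U :: "nat \<Rightarrow> grid" and \<Delta>t :: "nat \<Rightarrow> real" and GL GR :: "grid \<Rightarrow> state"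
  assumes "N \<ge> 2" "\<Delta>x > 0" "\<gamma> > 1" "pb > 0"
    and "admissible \<gamma> N (U 0)" "const_vel_pres \<gamma> N ub pb (U 0)"
    and step: "\<And>n. \<Delta>t n > 0 \<and> mpe_step \<gamma> N \<Delta>x GL GR (\<Delta>t n) (U n) (U (Suc n))"
    and gh: "\<And>n. const_vel_pres \<gamma> N ub pb (U n) \<Longrightarrow>
             vel (GL (U n)) = ub \<and> pres \<gamma> (GL (U n)) = pb \<and>
             vel (GR (U n)) = ub \<and> pres \<gamma> (GR (U n)) = pb"
  shows "admissible \<gamma> N (U n) \<and> const_vel_pres \<gamma> N ub pb (U n)"
\<comment> \<open>Admissibility joins the induction claim because each step needs it; positivity of
  the new density and \<open>pb > 0\<close> renew it.\<close>
proof (induction n)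
  case (Suc n)
  then have cvp: "const_vel_pres \<gamma> N ub pb (U (Suc n))" and "\<And>i. i \<in> {1..N} \<Longrightarrow> rho (U (Suc n) i) > 0"
    using mpe_step_const_vel_pres[of N \<Delta>x \<gamma> "\<Delta>t n" "U n" GL GR "U (Suc n)" ub pb] assms(1-3) step[of n] gh[of n]
    by auto
  then show ?case
    using \<open>pb > 0\<close> by (auto simp: admissible_def admissible_state_def const_vel_pres_def)
qed (use assms in auto)

theorem theorem3:
  fixes N :: nat and \<Delta>x \<gamma> :: real and GL GR :: "grid \<Rightarrow> state"
  assumes "N \<ge> 2" and "\<Delta>x > 0" and "\<gamma> > 1"
    and "ghost_map \<gamma> N GL" and "ghost_map \<gamma> N GR"
  shows
    "first_order_accurate \<gamma> N \<Delta>x GL GR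
     \<and>
     (\<forall>\<Delta>t>0. \<forall>Uo. admissible \<gamma> N Uo \<longrightarrow>
        (\<exists>V. mpe_step \<gamma> N \<Delta>x GL GR \<Delta>t Uo V \<and>
             (\<forall>V'. mpe_step \<gamma> N \<Delta>x GL GR \<Delta>t Uo V' \<longrightarrow> (\<forall>i\<in>{1..N}. V' i = V i)) \<and>
             (\<forall>i\<in>{1..N}. V i $ 1 > 0)))
     \<and>
     (\<forall>(U :: nat \<Rightarrow> grid) (\<Delta>t :: nat \<Rightarrow> real) ub pb.
        admissible \<gamma> N (U 0) \<and> pb > 0 \<and>
        (\<forall>n. \<Delta>t n > 0 \<and> mpe_step \<gamma> N \<Delta>x GL GR (\<Delta>t n) (U n) (U (Suc n))) \<and>
        const_vel_pres \<gamma> N ub pb (U 0) \<and>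
        (\<forall>n. const_vel_pres \<gamma> N ub pb (U n) \<longrightarrow>
             vel (GL (U n)) = ub \<and> pres \<gamma> (GL (U n)) = pb \<and>
             vel (GR (U n)) = ub \<and> pres \<gamma> (GR (U n)) = pb)
        \<longrightarrow> (\<forall>n. const_vel_pres \<gamma> N ub pb (U n)))"
proof (intro conjI)
  show "first_order_accurate \<gamma> N \<Delta>x GL GR" by (rule first_order_accurate_mpe) fact+
qed (use mpe_step_ex1[OF assms(1,2)] mpe_iterates_const_vel_pres[OF assms(1-3)] in blast)+

end
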